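(* For every real $a>0$ and all vector fields $X,Y,Z$ on $\mathbb{C}P^3$, writing $(X\wedge_a Y)Z = g_a(Y,Z)X-g_a(X,Z)Y$, the Riemann curvature tensor $R^a$ of $(\mathbb{C}P^3,g_a)$ is given by \begin{align*} R^a(X,Y)Z &= \frac{(a-1)(a+2)}{a^2}(X\wedge_a Y)Z\\ &\quad+\frac1a\Big((X\wedge_a Y)Z+(J_1X\wedge_a J_1Y)Z+2g_a(X,J_1Y)J_1Z\Big)\\ &\quad+\frac{1-a}{a^2}\Big((X\wedge_a Y)Z+(JX\wedge_a JY)Z+2g_a(X,JY)JZ\Big)\\ &\quad+\frac{1-a}{a}\Big((X\wedge_a Y)PZ+P(X\wedge_a Y)Z-\frac{a+2}{a}P(X\wedge_a Y)PZ\Big). \end{align*}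
   Context: Identify $\mathbb{R}^8\cong\mathbb{C}^4\cong\mathbb{H}^2$ via $(z_1,z_2,z_3,z_4)\leftrightarrow(z_1+z_2j,\,z_3+z_4j)$ and let $i,j,k$ act by left multiplication. Let $\pi:\mathbb{S}^7\subset\mathbb{C}^4\to\mathbb{C}P^3$ be the Hopf fibration (vertical space at $q$ spanned by $iq$), $g_1$ the Fubini–Study metric for which $\pi$ is a Riemannian submersion from the round sphere of constant curvature $1$, and $J_1$ the standard complex structure of $\mathbb{C}P^3$ (induced by multiplication by $i$). Define the distributions $\mathcal{D}_1^2(\pi(q))=d\pi_q(\mathrm{span}\{jq,kq\})$ and $\mathcal{D}_2^4(\pi(q))=d\pi_q(\mathrm{span}\{iq,jq,kq\}^\perp)$ (orthogonal complement in $T_q\mathbb{S}^7$); they are well defined, $J_1$-invariant, and $T\mathbb{C}P^3=\mathcal{D}_1^2\oplus\mathcal{D}_2^4$ is $g_1$-orthogonal. Define $J=-J_1$ on $\mathcal{D}_1^2$ and $J=J_1$ on $\mathcal{D}_2^4$, and $P=-JJ_1$, so $P=-\mathrm{Id}$ on $\mathcal{D}_1^2$ and $P=\mathrm{Id}$ on $\mathcal{D}_2^4$. For $a>0$ let $g_a$ be the metric equal to $g_1$ on $\mathcal{D}_1^2\times\mathcal{D}_1^2$, $a\,g_1$ on $\mathcal{D}_2^4\times\mathcal{D}_2^4$, and $0$ on $\mathcal{D}_1^2\times\mathcal{D}_2^4$. Curvature convention: $R(X,Y)Z=\nabla_X\nabla_YZ-\nabla_Y\nabla_XZ-\nabla_{[X,Y]}Z$.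 Expressions such as $P(X\wedge_aY)PZ$ mean composition of endomorphisms applied to $Z$. *)

theory Defs
  imports "HOL-Analysis.Analysis" "HOL-Library.Function_Algebras"
begin

text \<open>Pointwise scalar multiplication; addition, subtraction and zero are those of
  \<^theory>\<open>HOL-Library.Function_Algebras\<close>. Tangent vectors (functionals on smooth functions) and
  vector fields (families of tangent vectors) get their vector space structure from it.\<close>

instantiation "fun" :: (type, real_vector) real_vector
begin

definition scaleR_fun :: "real \<Rightarrow> ('a \<Rightarrow> 'b) \<Rightarrow> 'a \<Rightarrow> 'b"
  where "scaleR_fun r f = (\<lambda>x. r *\<^sub>R f x)"

instance
  by standard (simp_all add: scaleR_fun_def fun_eq_iff scaleR_add_right scaleR_add_left)

end

text \<open>Left multiplication by the unit quaternions under \<open>(z\<^sub>1, z\<^sub>2, z\<^sub>3, z\<^sub>4) \<leftrightarrow> (z\<^sub>1 + z\<^sub>2 j, z\<^sub>3 + z\<^sub>4 j)\<close>: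
  since \<open>j z = cnj z j\<close>, one has \<open>j (z\<^sub>1 + z\<^sub>2 j) = - cnj z\<^sub>2 + cnj z\<^sub>1 j\<close>.\<close>

definition mult_i :: "complex^4 \<Rightarrow> complex^4"
  where "mult_i q = \<i> *s q"

definition mult_j :: "complex^4 \<Rightarrow> complex^4"
  where "mult_j q = vector [- cnj (q $ 2), cnj (q $ 1), - cnj (q $ 4), cnj (q $ 3)]"

definition mult_k :: "complex^4 \<Rightarrow> complex^4"
  where "mult_k q = mult_i (mult_j q)"

typedef cp3 = "{range (\<lambda>c. c *s z) | z :: complex^4. z \<noteq> 0}"
  by (rule exI[of _ "range (\<lambda>c. c *s (1 :: complex^4))"]) (use one_neq_zero in blast)

text \<open>The projection is meaningful away from \<open>0\<close>; the Hopf fibration is its restriction to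
  \<open>sphere 0 1\<close>, the unit sphere of \<open>\<complex>\<^sup>4\<close> for the real inner product \<open>Re (\<Sum>i. z\<^sub>i cnj w\<^sub>i)\<close>.\<close>

definition proj :: "complex^4 \<Rightarrow> cp3"
  where "proj z = Abs_cp3 (range (\<lambda>c. c *s z))"

primrec Ck_on :: "nat \<Rightarrow> 'a::real_normed_vector set \<Rightarrow> ('a \<Rightarrow> 'b::real_normed_vector) \<Rightarrow> bool"
  where
    "Ck_on 0 S f \<longleftrightarrow> continuous_on S f"
  | "Ck_on (Suc k) S f \<longleftrightarrow>
       f differentiable_on S \<and> (\<forall>v. Ck_on k S (\<lambda>x. frechet_derivative f (at x) v))"

text \<open>The quotient smooth structure: as the projection is a surjective submersion from
  \<open>\<complex>\<^sup>4 - {0}\<close>, a function is smooth iff its pullback is.\<close>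

definition smooth_fun :: "(cp3 \<Rightarrow> real) \<Rightarrow> bool"
  where "smooth_fun f \<longleftrightarrow> (\<forall>k. Ck_on k (- {0}) (f \<circ> proj))"

text \<open>A tangent vector is the derivation \<open>f \<mapsto> (f \<circ> c)' 0\<close> given by a curve \<open>c\<close>. Functionals act on all
  functions but vanish on non-smooth ones, so they are determined by their action on smooth functions.\<close>

type_synonym tvec = "(cp3 \<Rightarrow> real) \<Rightarrow> real"
type_synonym vfield = "cp3 \<Rightarrow> tvec"
type_synonym metric = "cp3 \<Rightarrow> tvec \<Rightarrow> tvec \<Rightarrow> real"

text \<open>The differential of the Hopf fibration at \<open>q \<in> sphere 0 1\<close>, for \<open>v\<close> tangent to the sphere.\<close>

definition dproj :: "complex^4 \<Rightarrow> complex^4 \<Rightarrow> tvec"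
  where "dproj q v = (\<lambda>f. if smooth_fun f then frechet_derivative (f \<circ> proj) (at q) v else 0)"

definition tangent_sphere :: "complex^4 \<Rightarrow> (complex^4) set"
  where "tangent_sphere q = {v. v \<bullet> q = 0}"

definition tangent_space :: "cp3 \<Rightarrow> tvec set"
  where "tangent_space p = {dproj q v | q v. q \<in> sphere 0 1 \<and> proj q = p \<and> v \<in> tangent_sphere q}"

definition deriv_along :: "vfield \<Rightarrow> (cp3 \<Rightarrow> real) \<Rightarrow> cp3 \<Rightarrow> real"
  where "deriv_along X f = (\<lambda>p. X p f)"

definition vector_fields :: "vfield set"
  where "vector_fields =
    {X. (\<forall>p. X p \<in> tangent_space p) \<and> (\<forall>f. smooth_fun f \<longrightarrow> smooth_fun (deriv_along X f))}"

definition bracket :: "vfield \<Rightarrow> vfield \<Rightarrow> vfield"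
  where "bracket X Y = (\<lambda>p f. X p (deriv_along Y f) - Y p (deriv_along X f))"

definition is_connection :: "(vfield \<Rightarrow> vfield \<Rightarrow> vfield) \<Rightarrow> bool"
  where "is_connection D \<longleftrightarrow>
    (\<forall>X\<in>vector_fields. \<forall>Y\<in>vector_fields. D X Y \<in> vector_fields) \<and>
    (\<forall>X\<in>vector_fields. \<forall>X'\<in>vector_fields. \<forall>Y\<in>vector_fields. D (X + X') Y = D X Y + D X' Y) \<and>
    (\<forall>X\<in>vector_fields. \<forall>Y\<in>vector_fields. \<forall>Y'\<in>vector_fields. D X (Y + Y') = D X Y + D X Y') \<and>
    (\<forall>f. \<forall>X\<in>vector_fields. \<forall>Y\<in>vector_fields. smooth_fun f \<longrightarrow>
       D (\<lambda>p. f p *\<^sub>R X p) Y = (\<lambda>p. f p *\<^sub>R D X Y p)) \<and>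
    (\<forall>f. \<forall>X\<in>vector_fields. \<forall>Y\<in>vector_fields. smooth_fun f \<longrightarrow>
       D X (\<lambda>p. f p *\<^sub>R Y p) = (\<lambda>p. deriv_along X f p *\<^sub>R Y p + f p *\<^sub>R D X Y p))"

definition torsion_free :: "(vfield \<Rightarrow> vfield \<Rightarrow> vfield) \<Rightarrow> bool"
  where "torsion_free D \<longleftrightarrow>
    (\<forall>X\<in>vector_fields. \<forall>Y\<in>vector_fields. D X Y - D Y X = bracket X Y)"

definition metric_compatible :: "metric \<Rightarrow> (vfield \<Rightarrow> vfield \<Rightarrow> vfield) \<Rightarrow> bool"
  where "metric_compatible g D \<longleftrightarrow>
    (\<forall>X\<in>vector_fields. \<forall>Y\<in>vector_fields. \<forall>Z\<in>vector_fields. \<forall>p.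
       deriv_along X (\<lambda>p. g p (Y p) (Z p)) p = g p (D X Y p) (Z p) + g p (Y p) (D X Z p))"

text \<open>HOL functions are total: outside \<open>vector_fields\<close> the connection is set to \<open>0\<close>, so that
  uniqueness of the Levi-Civita connection is equality of functions.\<close>

definition levi_civita :: "metric \<Rightarrow> vfield \<Rightarrow> vfield \<Rightarrow> vfield"
  where "levi_civita g = (THE D. is_connection D \<and> torsion_free D \<and> metric_compatible g D \<and>
    (\<forall>X Y. X \<notin> vector_fields \<or> Y \<notin> vector_fields \<longrightarrow> D X Y = 0))"

definition riemann :: "metric \<Rightarrow> vfield \<Rightarrow> vfield \<Rightarrow> vfield \<Rightarrow> vfield"
  where "riemann g X Y Z =
    levi_civita g X (levi_civita g Y Z) - levi_civita g Y (levi_civita g X Z)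
    - levi_civita g (bracket X Y) Z"

definition horizontal :: "complex^4 \<Rightarrow> (complex^4) set"
  where "horizontal q = {v \<in> tangent_sphere q. v \<bullet> mult_i q = 0}"

text \<open>The Fubini-Study metric and the standard complex structure, characterised through horizontal
  lifts at an arbitrary point \<open>q\<close> of the fibre; the values do not depend on \<open>q\<close>.\<close>

definition g1 :: metric
  where "g1 p u v = (THE r. \<forall>q\<in>sphere 0 1. \<forall>x\<in>horizontal q. \<forall>y\<in>horizontal q.
    proj q = p \<and> dproj q x = u \<and> dproj q y = v \<longrightarrow> r = x \<bullet> y)"

definition J1 :: "cp3 \<Rightarrow> tvec \<Rightarrow> tvec"
  where "J1 p u = (THE w. \<forall>q\<in>sphere 0 1. \<forall>x\<in>horizontal q.
    proj q = p \<and> dproj q x = u \<longrightarrow> w = dproj q (mult_i x))"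

definition D1 :: "cp3 \<Rightarrow> tvec set"
  where "D1 p = {dproj q v | q v. q \<in> sphere 0 1 \<and> proj q = p \<and> v \<in> span {mult_j q, mult_k q}}"

definition D2 :: "cp3 \<Rightarrow> tvec set"
  where "D2 p = {dproj q v | q v. q \<in> sphere 0 1 \<and> proj q = p \<and> v \<in> tangent_sphere q \<and>
    v \<bullet> mult_i q = 0 \<and> v \<bullet> mult_j q = 0 \<and> v \<bullet> mult_k q = 0}"

text \<open>Well defined on \<open>tangent_space p = D1 p \<oplus> D2 p\<close>.\<close>

definition pr1 :: "cp3 \<Rightarrow> tvec \<Rightarrow> tvec"
  where "pr1 p u = (THE u1. u1 \<in> D1 p \<and> u - u1 \<in> D2 p)"

definition pr2 :: "cp3 \<Rightarrow> tvec \<Rightarrow> tvec"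
  where "pr2 p u = u - pr1 p u"

definition J :: "cp3 \<Rightarrow> tvec \<Rightarrow> tvec"
  where "J p u = - J1 p (pr1 p u) + J1 p (pr2 p u)"

definition P :: "cp3 \<Rightarrow> tvec \<Rightarrow> tvec"
  where "P p u = - J p (J1 p u)"

definition ga :: "real \<Rightarrow> metric"
  where "ga a p u v = g1 p (pr1 p u) (pr1 p v) + a * g1 p (pr2 p u) (pr2 p v)"

definition wedge :: "real \<Rightarrow> cp3 \<Rightarrow> tvec \<Rightarrow> tvec \<Rightarrow> tvec \<Rightarrow> tvec"
  where "wedge a p u v w = ga a p v w *\<^sub>R u - ga a p u w *\<^sub>R v"

end

(*
  A vector field on CP^3 is the same thing as a smooth C^*-equivariant horizontal field on C^4 - {0};
  its horizontal lift is a smooth function with values in a vector space, so all derivatives become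
  ordinary ones. With kappa = (1 - a) / a, the Levi-Civita connection of g_a lifts to

    (y, z)  |->  horizontal part of  Dz(y) + kappa / |q|^2 * T(y, z),
    T(y, z) = <z,jq> jy + <z,kq> ky + <y,jq> jz + <y,kq> kz :

  the first summand is the Fubini-Study connection and the T-term is the difference tensor, found by
  solving the Koszul formula for the derivative of P. In the curvature at a unit vector q all
  derivatives of the lifts cancel. What remains is polynomial in inner products, and agrees with the
  claimed formula because the quaternionic complement of Hq in H^2 has real dimension 4.
*)

theory Submission
  imports Defs
begin

section \<open>Smooth functions on open sets\<close>

text \<open>On the open set C^4 - {0} all derivatives are ordinary, but fibre directions enter the
  calculus. Equivariance controls them: Dz(q)(cq) = c z(q). At a unit q the lift of a bracket is the
  bracket of the lifts plus the vertical vector 2 <y,ix> iq, and Dz along that vector produces, for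
  a = 1, the term 2 g(X, J1 Y) J1 Z.

  A vector field is known only through its action on functions, so smoothness of its lift has to
  come from an explicit formula in finitely many smooth test functions.

  Origin of kappa: let theta_j(x) = <x,jq> and theta_k(x) = <x,kq>. At a unit q the metric is a
  <.,.> + (1 - a)(theta_j^2 + theta_k^2), and the covariant derivative of theta_j along u is x |->
  <x,ju>, which is skew. In the Koszul formula the skew terms cancel or double, leaving g_a(D(y,z),
  w) = (1 - a) <T(y,z), w> for the difference D of the two connections. For horizontal y, z the
  vector T(y,z) is orthogonal to jq and kq, so its horizontal part lies in the second distribution,
  where g_a is a times the Fubini-Study metric; hence the quotient (1 - a) / a.\<close>

definition smooth_on :: "'a::real_normed_vector set \<Rightarrow> ('a \<Rightarrow> 'b::real_normed_vector) \<Rightarrow> bool"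
  where "smooth_on S f \<longleftrightarrow> (\<forall>k. Ck_on k S f)"

lemma Ck_on_SucD:
  assumes "open S" "Ck_on (Suc k) S f" "x \<in> S"
  shows "(f has_derivative frechet_derivative f (at x)) (at x)"
  using assms by (simp add: differentiable_on_eq_differentiable_at frechet_derivative_works)

lemma Ck_on_cong:
  assumes "open S"
  shows "(\<And>x. x \<in> S \<Longrightarrow> f x = g x) \<Longrightarrow> Ck_on k S f \<Longrightarrow> Ck_on k S g"
proof (induction k arbitrary: f g)
  case 0
  then show ?case using continuous_on_cong by (metis Ck_on.simps(1))
next
  case (Suc k)
  have d: "(g has_derivative frechet_derivative f (at x)) (at x)" if "x \<in> S" for x
    using has_derivative_transform_within_open[OF Ck_on_SucD[OF assms Suc.prems(2) that] assms that]
      Suc.prems(1) by blast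
  have "g differentiable_on S"
    using d assms by (meson differentiable_def differentiable_on_eq_differentiable_at)
  moreover have "Ck_on k S (\<lambda>x. frechet_derivative g (at x) v)" for v
  proof (rule Suc.IH)
    show "Ck_on k S (\<lambda>x. frechet_derivative f (at x) v)"
      using Suc.prems(2) by simp
  qed (metis d frechet_derivative_at)
  ultimately show ?case
    by simp
qed

text \<open>\<open>Ck_on\<close> speaks about \<open>frechet_derivative\<close>, a choice operator.
  On an open set derivatives are unique, so any pointwise formula \<open>f'\<close> may stand in for
  it. The closure proofs for linear and bilinear maps, sums and inverses enter through this
  rule.\<close>

lemma Ck_on_Suc:
  assumes "open S" "\<And>x. x \<in> S \<Longrightarrow> (f has_derivative f' x) (at x)" "\<And>v. Ck_on k S (\<lambda>x. f' x v)"
  shows "Ck_on (Suc k) S f"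
proof -
  have "f differentiable_on S"
    using assms(1,2) by (meson differentiable_def differentiable_on_eq_differentiable_at)
  moreover have "Ck_on k S (\<lambda>x. frechet_derivative f (at x) v)" for v
    by (rule Ck_on_cong[OF assms(1) _ assms(3)[of v]]) (metis assms(2) frechet_derivative_at)
  ultimately show ?thesis
    by simp
qed

lemma Ck_on_Suc_imp: "Ck_on (Suc k) S f \<Longrightarrow> Ck_on k S f"
proof (induction k arbitrary: f)
  case 0
  then show ?case by (simp add: differentiable_imp_continuous_on)
next
  case (Suc k)
  then show ?case by (metis Ck_on.simps(2))
qed

lemma Ck_on_const: "Ck_on k S (\<lambda>x. c)"
  by (induction k arbitrary: c) auto

lemma Ck_on_bounded_linear:
  assumes "open S" "bounded_linear L"
  shows "Ck_on k S f \<Longrightarrow> Ck_on k S (\<lambda>x. L (f x))"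
proof (induction k arbitrary: f)
  case 0
  then show ?case using bounded_linear.continuous_on[OF assms(2)] by auto
next
  case (Suc k)
  show ?case
  proof (rule Ck_on_Suc[OF assms(1)])
    show "((\<lambda>x. L (f x)) has_derivative (\<lambda>v. L (frechet_derivative f (at x) v))) (at x)" if "x \<in> S" for x
      using bounded_linear.has_derivative[OF assms(2)] Ck_on_SucD[OF assms(1) Suc.prems that] by blast
  qed (use Suc in auto)
qed

lemma Ck_on_add:
  assumes "open S"
  shows "Ck_on k S f \<Longrightarrow> Ck_on k S g \<Longrightarrow> Ck_on k S (\<lambda>x. f x + g x)"
proof (induction k arbitrary: f g)
  case 0
  then show ?case by (auto intro: continuous_intros)
next
  case (Suc k)
  show ?case
  proof (rule Ck_on_Suc[OF assms(1)])
    show "((\<lambda>x. f x + g x) has_derivative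
        (\<lambda>v. frechet_derivative f (at x) v + frechet_derivative g (at x) v)) (at x)" if "x \<in> S" for x
      using has_derivative_add Ck_on_SucD[OF assms(1) _ that] Suc.prems by blast
  qed (use Suc in auto)
qed

lemma Ck_on_bounded_bilinear:
  assumes "open S" "bounded_bilinear B"
  shows "Ck_on k S f \<Longrightarrow> Ck_on k S g \<Longrightarrow> Ck_on k S (\<lambda>x. B (f x) (g x))"
proof (induction k arbitrary: f g)
  case 0
  then show ?case by (simp add: bounded_bilinear.continuous_on[OF assms(2)])
next
  case (Suc k)
  show ?case
  proof (rule Ck_on_Suc[OF assms(1)])
    show "((\<lambda>x. B (f x) (g x)) has_derivative (\<lambda>v. B (f x) (frechet_derivative g (at x) v) +
        B (frechet_derivative f (at x) v) (g x))) (at x)" if "x \<in> S" for x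
      by (rule bounded_bilinear.FDERIV[OF assms(2) Ck_on_SucD[OF assms(1) Suc.prems(1) that]
            Ck_on_SucD[OF assms(1) Suc.prems(2) that]])
    show "Ck_on k S (\<lambda>x. B (f x) (frechet_derivative g (at x) v) +
        B (frechet_derivative f (at x) v) (g x))" for v
      using Suc.prems
      by (intro Ck_on_add assms(1) Suc.IH Ck_on_Suc_imp[OF Suc.prems(1)] Ck_on_Suc_imp[OF Suc.prems(2)]) auto
  qed
qed

text \<open>The derivative - (1/f) f' (1/f) contains 1/f itself, which is C^k by the induction
  hypothesis, so the induction runs with f fixed.\<close>

lemma Ck_on_inverse:
  fixes f :: "'a::real_normed_vector \<Rightarrow> real"
  assumes "open S" "\<And>x. x \<in> S \<Longrightarrow> f x \<noteq> 0"
  shows "Ck_on k S f \<Longrightarrow> Ck_on k S (\<lambda>x. inverse (f x))"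
proof (induction k)
  case 0
  then show ?case using assms(2) by (auto intro: continuous_intros)
next
  case (Suc k)
  have "Ck_on k S (\<lambda>x. inverse (f x))"
    using Suc by (simp add: Ck_on_Suc_imp)
  moreover have "Ck_on k S (\<lambda>x. frechet_derivative f (at x) v)" for v
    using Suc.prems by simp
  ultimately have "Ck_on k S (\<lambda>x. - (inverse (f x) * frechet_derivative f (at x) v * inverse (f x)))" for v
    by (intro Ck_on_bounded_linear[OF assms(1) bounded_linear_minus[OF bounded_linear_ident]]
        Ck_on_bounded_bilinear[OF assms(1) bounded_bilinear_mult])
  moreover have "((\<lambda>x. inverse (f x)) has_derivative
      (\<lambda>v. - (inverse (f x) * frechet_derivative f (at x) v * inverse (f x)))) (at x)" if "x \<in> S" for x
    using Deriv.has_derivative_inverse[OF assms(2)[OF that] Ck_on_SucD[OF assms(1) Suc.prems that]] .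
  ultimately show ?case
    by (intro Ck_on_Suc[OF assms(1)])
qed

lemma smooth_on_cong:
  "open S \<Longrightarrow> (\<And>x. x \<in> S \<Longrightarrow> f x = g x) \<Longrightarrow> smooth_on S f \<Longrightarrow> smooth_on S g"
  unfolding smooth_on_def using Ck_on_cong by blast

lemma smooth_on_const: "smooth_on S (\<lambda>x. c)"
  by (simp add: smooth_on_def Ck_on_const)

lemma smooth_on_ident: "open S \<Longrightarrow> smooth_on S (\<lambda>x. x)"
  unfolding smooth_on_def
proof
  fix k
  assume "open S"
  then show "Ck_on k S (\<lambda>x. x)"
    by (cases k) (auto simp: Ck_on_const)
qed

lemma smooth_on_bounded_linear:
  "open S \<Longrightarrow> bounded_linear L \<Longrightarrow> smooth_on S f \<Longrightarrow> smooth_on S (\<lambda>x. L (f x))"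
  by (simp add: smooth_on_def Ck_on_bounded_linear)

lemma smooth_on_bounded_bilinear:
  "open S \<Longrightarrow> bounded_bilinear B \<Longrightarrow> smooth_on S f \<Longrightarrow> smooth_on S g \<Longrightarrow>
    smooth_on S (\<lambda>x. B (f x) (g x))"
  by (simp add: smooth_on_def Ck_on_bounded_bilinear)

lemmas smooth_on_inner = smooth_on_bounded_bilinear[OF _ bounded_bilinear_inner]
lemmas smooth_on_mult = smooth_on_bounded_bilinear[OF _ bounded_bilinear_mult]
lemmas smooth_on_scaleR = smooth_on_bounded_bilinear[OF _ bounded_bilinear_scaleR]
lemmas smooth_on_minus = smooth_on_bounded_linear[OF _ bounded_linear_minus[OF bounded_linear_ident]]

lemma smooth_on_add:
  "open S \<Longrightarrow> smooth_on S f \<Longrightarrow> smooth_on S g \<Longrightarrow> smooth_on S (\<lambda>x. f x + g x)"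
  by (simp add: smooth_on_def Ck_on_add)

lemma smooth_on_diff:
  "open S \<Longrightarrow> smooth_on S f \<Longrightarrow> smooth_on S g \<Longrightarrow> smooth_on S (\<lambda>x. f x - g x)"
  using smooth_on_add[OF _ _ smooth_on_minus, of S f g] by simp

lemma smooth_on_sum:
  "open S \<Longrightarrow> (\<And>i. i \<in> A \<Longrightarrow> smooth_on S (f i)) \<Longrightarrow> smooth_on S (\<lambda>x. \<Sum>i\<in>A. f i x)"
  by (induction A rule: infinite_finite_induct) (auto intro: smooth_on_const smooth_on_add)

lemma smooth_on_divide:
  fixes f g :: "'a::real_normed_vector \<Rightarrow> real"
  shows "open S \<Longrightarrow> smooth_on S f \<Longrightarrow> smooth_on S g \<Longrightarrow> (\<And>x. x \<in> S \<Longrightarrow> g x \<noteq> 0) \<Longrightarrow>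
    smooth_on S (\<lambda>x. f x / g x)"
  unfolding divide_inverse
  by (rule smooth_on_mult) (auto simp: smooth_on_def Ck_on_inverse)

section \<open>Derivatives along moving directions; symmetry of second derivatives\<close>

lemma smooth_on_has_derivative:
  "open S \<Longrightarrow> smooth_on S f \<Longrightarrow> x \<in> S \<Longrightarrow> (f has_derivative frechet_derivative f (at x)) (at x)"
  using Ck_on_SucD unfolding smooth_on_def by blast

lemma smooth_on_frechet_derivative:
  "smooth_on S f \<Longrightarrow> smooth_on S (\<lambda>x. frechet_derivative f (at x) v)"
  unfolding smooth_on_def by (metis Ck_on.simps(2))

lemma frechet_derivative_Basis_sum:
  assumes "f differentiable (at x)"
  shows "frechet_derivative f (at x) v = (\<Sum>b\<in>Basis. (v \<bullet> b) *\<^sub>R frechet_derivative f (at x) b)"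
proof -
  have "linear (frechet_derivative f (at x))"
    using assms by (rule linear_frechet_derivative)
  then have "frechet_derivative f (at x) (\<Sum>b\<in>Basis. (v \<bullet> b) *\<^sub>R b) =
      (\<Sum>b\<in>Basis. (v \<bullet> b) *\<^sub>R frechet_derivative f (at x) b)"
    by (simp add: linear_sum linear_cmul)
  then show ?thesis
    by (simp add: euclidean_representation)
qed

text \<open>\<open>Ck_on\<close> differentiates in constant directions only; expanding the moving
  direction in a basis reduces to those.\<close>

lemma smooth_on_frechet_derivative_along:
  fixes y :: "'a::euclidean_space \<Rightarrow> 'a"
  assumes "open S" "smooth_on S f" "smooth_on S y"
  shows "smooth_on S (\<lambda>x. frechet_derivative f (at x) (y x))"
proof (rule smooth_on_cong[OF assms(1)])
  show "smooth_on S (\<lambda>x. \<Sum>b\<in>Basis. (y x \<bullet> b) *\<^sub>R frechet_derivative f (at x) b)"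
    using assms
    by (intro smooth_on_sum smooth_on_scaleR smooth_on_inner smooth_on_const
        smooth_on_frechet_derivative)
  show "(\<Sum>b\<in>Basis. (y x \<bullet> b) *\<^sub>R frechet_derivative f (at x) b) = frechet_derivative f (at x) (y x)"
    if "x \<in> S" for x
    using frechet_derivative_Basis_sum[of f x "y x"] smooth_on_has_derivative[OF assms(1,2) that]
    by (metis differentiable_def)
qed

text \<open>The second difference f(x+hu+hv) - f(x+hu) - f(x+hv) + f(x) is symmetric in u and v. Two
  uses of the mean value theorem turn it into h^2 times a mixed derivative at a nearby point, in
  either order; continuity of the mixed derivatives then lets h tend to 0.\<close>

lemma frechet_derivative_symmetric_real:
  fixes f :: "'a::real_normed_vector \<Rightarrow> real"
  assumes "open S" "smooth_on S f" "x \<in> S"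
  shows "frechet_derivative (\<lambda>x. frechet_derivative f (at x) u) (at x) v =
    frechet_derivative (\<lambda>x. frechet_derivative f (at x) v) (at x) u"
proof -
  define F where "F = (\<lambda>u x. frechet_derivative f (at x) u)"
  define G where "G = (\<lambda>u v x. frechet_derivative (F u) (at x) v)"
  have sF: "smooth_on S (F u)" and sG: "smooth_on S (G u v)" for u v
    using assms(2) by (simp_all add: F_def G_def smooth_on_frechet_derivative)
  have dF: "(f has_derivative (\<lambda>u. F u y)) (at y)" if "y \<in> S" for y
    using smooth_on_has_derivative[OF assms(1,2) that] by (simp add: F_def)
  have dG: "(F u has_derivative (\<lambda>v. G u v y)) (at y)" if "y \<in> S" for u y
    using smooth_on_has_derivative[OF assms(1) sF that] by (simp add: G_def)
  obtain e where e: "e > 0" "ball x e \<subseteq> S"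
    using assms(1,3) openE by blast
  \<comment> \<open>Small enough for the parallelograms with sides below d u and d v to stay in the
    ball; the summand 1 covers u = v = 0.\<close>
  define d where "d = e / (norm u + norm v + 1)"
  have pos: "norm u + norm v + 1 > 0"
    by (smt (verit) norm_ge_zero)
  then have d: "d > 0"
    using e by (simp add: d_def)
  have inS: "x + s *\<^sub>R a + t *\<^sub>R b \<in> S"
    if "0 \<le> s" "0 \<le> t" "s < d" "t < d" and ab: "a = u \<and> b = v \<or> a = v \<and> b = u" for s t a b
  proof -
    have "norm (s *\<^sub>R a + t *\<^sub>R b) \<le> s * norm a + t * norm b"
      using that norm_triangle_ineq[of "s *\<^sub>R a" "t *\<^sub>R b"] by simp
    also have "\<dots> \<le> d * norm a + d * norm b"
      using that by (intro add_mono mult_right_mono) auto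
    also have "\<dots> < d * (norm u + norm v + 1)"
      using d ab by (auto simp: algebra_simps)
    also have "\<dots> = e"
      using pos by (simp add: d_def)
    finally have "dist (x + s *\<^sub>R a + t *\<^sub>R b) x < e"
      by (simp add: dist_norm add.assoc)
    then show ?thesis
      using e by (auto simp: dist_commute)
  qed
  have mvt: "\<exists>\<xi> \<eta>. 0 < \<xi> \<and> \<xi> < h \<and> 0 < \<eta> \<and> \<eta> < h \<and>
      f (x + h *\<^sub>R a + h *\<^sub>R b) - f (x + h *\<^sub>R a) - f (x + h *\<^sub>R b) + f x =
      h * (h * G a b (x + \<xi> *\<^sub>R a + \<eta> *\<^sub>R b))"
    if h: "0 < h" "h < d" and ab: "a = u \<and> b = v \<or> a = v \<and> b = u" for h a b
  proof -
    have D1: "((\<lambda>s. f (x + s *\<^sub>R a + h *\<^sub>R b) - f (x + s *\<^sub>R a)) has_derivative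
        (\<lambda>t. t * (F a (x + s *\<^sub>R a + h *\<^sub>R b) - F a (x + s *\<^sub>R a)))) (at s)"
      if "0 \<le> s" "s \<le> h" for s
    proof -
      have i: "x + s *\<^sub>R a + h *\<^sub>R b \<in> S" "x + s *\<^sub>R a \<in> S"
        using inS[of s h a b] inS[of s 0 a b] h ab that by auto
      have lin: "F (t *\<^sub>R a) y = t * F a y" if "y \<in> S" for t y
        using linear_cmul[OF has_derivative_linear[OF dF[OF that]], of t a] by simp
      show ?thesis
        by (rule has_derivative_eq_rhs, (rule derivative_eq_intros has_derivative_compose[OF _ dF] i refl)+)
           (simp add: lin[OF i(1)] lin[OF i(2), simplified] fun_eq_iff right_diff_distrib)
    qed
    obtain \<xi> where \<xi>: "0 < \<xi>" "\<xi> < h"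
      "f (x + h *\<^sub>R a + h *\<^sub>R b) - f (x + h *\<^sub>R a) - (f (x + h *\<^sub>R b) - f x) =
        h * (F a (x + \<xi> *\<^sub>R a + h *\<^sub>R b) - F a (x + \<xi> *\<^sub>R a))"
      using mvt_simple[of 0 h "\<lambda>s. f (x + s *\<^sub>R a + h *\<^sub>R b) - f (x + s *\<^sub>R a)"
          "\<lambda>s t. t * (F a (x + s *\<^sub>R a + h *\<^sub>R b) - F a (x + s *\<^sub>R a))"]
        h D1 has_derivative_at_withinI by fastforce
    have D2: "((\<lambda>s. F a (x + \<xi> *\<^sub>R a + s *\<^sub>R b)) has_derivative
        (\<lambda>t. t * G a b (x + \<xi> *\<^sub>R a + s *\<^sub>R b))) (at s)"
      if "0 \<le> s" "s \<le> h" for s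
    proof -
      have i: "x + \<xi> *\<^sub>R a + s *\<^sub>R b \<in> S"
        using inS[of \<xi> s a b] h ab that \<xi> by auto
      have lin: "G a (t *\<^sub>R b) (x + \<xi> *\<^sub>R a + s *\<^sub>R b) = t * G a b (x + \<xi> *\<^sub>R a + s *\<^sub>R b)" for t
        using linear_cmul[OF has_derivative_linear[OF dG[OF i]], of a t b] by simp
      show ?thesis
        by (rule has_derivative_eq_rhs, (rule derivative_eq_intros has_derivative_compose[OF _ dG] i refl)+)
           (simp add: lin fun_eq_iff)
    qed
    obtain \<eta> where \<eta>: "0 < \<eta>" "\<eta> < h"
      "F a (x + \<xi> *\<^sub>R a + h *\<^sub>R b) - F a (x + \<xi> *\<^sub>R a) = h * G a b (x + \<xi> *\<^sub>R a + \<eta> *\<^sub>R b)"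
      using mvt_simple[of 0 h "\<lambda>s. F a (x + \<xi> *\<^sub>R a + s *\<^sub>R b)"
          "\<lambda>s t. t * G a b (x + \<xi> *\<^sub>R a + s *\<^sub>R b)"]
        h D2 has_derivative_at_withinI by fastforce
    show ?thesis
      using \<xi> \<eta> by (intro exI[of _ \<xi>] exI[of _ \<eta>]) auto
  qed
  have close: "\<exists>r>0. \<forall>y. dist y x < r \<longrightarrow> \<bar>G a b y - G a b x\<bar> < \<epsilon>" if "\<epsilon> > 0" for \<epsilon> a b
    using continuous_onI assms(1,3) sG[of a b] that
    unfolding smooth_on_def
    by (metis Ck_on.simps(1) continuous_at_eps_delta continuous_on_eq_continuous_at dist_real_def)
  have "\<bar>G u v x - G v u x\<bar> \<le> \<epsilon>" if eps: "\<epsilon> > 0" for \<epsilon>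
  proof -
    obtain r1 where r1: "r1 > 0" "\<And>y. dist y x < r1 \<Longrightarrow> \<bar>G u v y - G u v x\<bar> < \<epsilon> / 2"
      using close[of "\<epsilon> / 2" u v] eps by auto
    obtain r2 where r2: "r2 > 0" "\<And>y. dist y x < r2 \<Longrightarrow> \<bar>G v u y - G v u x\<bar> < \<epsilon> / 2"
      using close[of "\<epsilon> / 2" v u] eps by auto
    \<comment> \<open>The first bound gives h < d; the second keeps the intermediate points of both
      orders within r1 and r2 of x.\<close>
    define h where "h = min (d / 2) (min r1 r2 / (norm u + norm v + 1))"
    have h: "0 < h" "h < d" "h * (norm u + norm v + 1) \<le> min r1 r2"
    proof -
      show "0 < h"
        using d r1(1) r2(1) pos by (simp add: h_def)
      show "h < d"
        using d by (simp add: h_def min_less_iff_disj)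
      have "h \<le> min r1 r2 / (norm u + norm v + 1)"
        unfolding h_def by (rule min.cobounded2)
      then show "h * (norm u + norm v + 1) \<le> min r1 r2"
        using pos_le_divide_eq[OF pos] by blast
    qed
    have near: "dist (x + s *\<^sub>R a + t *\<^sub>R b) x < min r1 r2"
      if "0 < s" "0 < t" "s < h" "t < h" and ab: "a = u \<and> b = v \<or> a = v \<and> b = u" for s t a b
    proof -
      have "norm (s *\<^sub>R a + t *\<^sub>R b) \<le> s * norm a + t * norm b"
        using that norm_triangle_ineq[of "s *\<^sub>R a" "t *\<^sub>R b"] by simp
      also have "\<dots> \<le> h * norm a + h * norm b"
        using that by (intro add_mono mult_right_mono) auto
      also have "\<dots> < h * (norm u + norm v + 1)"
        using h ab by (auto simp: algebra_simps)
      finally show ?thesis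
        using h by (simp add: dist_norm add.assoc)
    qed
    obtain \<xi> \<eta> where 1: "0 < \<xi>" "\<xi> < h" "0 < \<eta>" "\<eta> < h"
      "f (x + h *\<^sub>R u + h *\<^sub>R v) - f (x + h *\<^sub>R u) - f (x + h *\<^sub>R v) + f x =
        h * (h * G u v (x + \<xi> *\<^sub>R u + \<eta> *\<^sub>R v))"
      using mvt[of h u v] h by blast
    obtain \<xi>' \<eta>' where 2: "0 < \<xi>'" "\<xi>' < h" "0 < \<eta>'" "\<eta>' < h"
      "f (x + h *\<^sub>R v + h *\<^sub>R u) - f (x + h *\<^sub>R v) - f (x + h *\<^sub>R u) + f x =
        h * (h * G v u (x + \<xi>' *\<^sub>R v + \<eta>' *\<^sub>R u))"
      using mvt[of h v u] h by blast
    have "x + h *\<^sub>R v + h *\<^sub>R u = x + h *\<^sub>R u + h *\<^sub>R v"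
      by simp
    then have "h * (h * G u v (x + \<xi> *\<^sub>R u + \<eta> *\<^sub>R v)) = h * (h * G v u (x + \<xi>' *\<^sub>R v + \<eta>' *\<^sub>R u))"
      using 1(5) 2(5) by (smt (verit))
    then have "G u v (x + \<xi> *\<^sub>R u + \<eta> *\<^sub>R v) = G v u (x + \<xi>' *\<^sub>R v + \<eta>' *\<^sub>R u)"
      using h by simp
    moreover have "\<bar>G u v (x + \<xi> *\<^sub>R u + \<eta> *\<^sub>R v) - G u v x\<bar> < \<epsilon> / 2"
      using near[of \<xi> \<eta> u v] 1 by (intro r1) auto
    moreover have "\<bar>G v u (x + \<xi>' *\<^sub>R v + \<eta>' *\<^sub>R u) - G v u x\<bar> < \<epsilon> / 2"
      using near[of \<xi>' \<eta>' v u] 2 by (intro r2) auto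
    ultimately show ?thesis
      by linarith
  qed
  then have "\<bar>G u v x - G v u x\<bar> \<le> 0"
    by (rule field_le_epsilon) simp
  then show ?thesis
    by (simp add: G_def F_def)
qed

lemma frechet_derivative_symmetric:
  fixes f :: "'a::real_normed_vector \<Rightarrow> 'b::euclidean_space"
  assumes S: "open S" "x \<in> S" and f: "smooth_on S f"
  shows "frechet_derivative (\<lambda>x. frechet_derivative f (at x) u) (at x) v =
    frechet_derivative (\<lambda>x. frechet_derivative f (at x) v) (at x) u"
proof (rule euclidean_eqI)
  fix b :: 'b
  have fr: "frechet_derivative (\<lambda>x. g x \<bullet> b) (at z) w = frechet_derivative g (at z) w \<bullet> b"
    if "smooth_on S g" "z \<in> S" for g :: "'a \<Rightarrow> 'b" and z w
    using frechet_derivative_at[OF has_derivative_inner_left[OF smooth_on_has_derivative[OF S(1) that], of b]]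
    by (metis (no_types))
  have fb: "smooth_on S (\<lambda>x. f x \<bullet> b)"
    using smooth_on_inner[OF S(1) f smooth_on_const] .
  have "frechet_derivative (\<lambda>x. frechet_derivative f (at x) u) (at x) v \<bullet> b =
      frechet_derivative (\<lambda>x. frechet_derivative (\<lambda>x. f x \<bullet> b) (at x) u) (at x) v" for u v
  proof -
    have "frechet_derivative (\<lambda>x. frechet_derivative (\<lambda>x. f x \<bullet> b) (at x) u) (at x) =
        frechet_derivative (\<lambda>x. frechet_derivative f (at x) u \<bullet> b) (at x)"
      by (rule frechet_derivative_transform_within_open[OF _ S])
         (use smooth_on_has_derivative[OF S(1) smooth_on_frechet_derivative[OF fb] S(2)] f
           in \<open>auto simp: differentiable_def fr\<close>)
    then show ?thesis
      by (simp add: fr[OF smooth_on_frechet_derivative[OF f] S(2)])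
  qed
  then show "frechet_derivative (\<lambda>x. frechet_derivative f (at x) u) (at x) v \<bullet> b =
      frechet_derivative (\<lambda>x. frechet_derivative f (at x) v) (at x) u \<bullet> b"
    using frechet_derivative_symmetric_real[OF S(1) fb S(2)] by simp
qed

lemma has_derivative_frechet_derivative_along:
  fixes f :: "'a::euclidean_space \<Rightarrow> 'b::real_normed_vector" and y :: "'a \<Rightarrow> 'a"
  assumes S: "open S" "x \<in> S" and f: "smooth_on S f" and y: "(y has_derivative y') (at x)"
    and w: "w = y x"
  shows "((\<lambda>x. frechet_derivative f (at x) (y x)) has_derivative
    (\<lambda>v. frechet_derivative (\<lambda>x. frechet_derivative f (at x) w) (at x) v +
      frechet_derivative f (at x) (y' v))) (at x)"
proof -
  define F where "F b z = frechet_derivative f (at z) b" for b z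
  have sum: "frechet_derivative f (at z) v = (\<Sum>b\<in>Basis. (v \<bullet> b) *\<^sub>R F b z)" if "z \<in> S" for z v
    unfolding F_def
    using frechet_derivative_Basis_sum[of f z v] smooth_on_has_derivative[OF S(1) f that]
    by (auto simp: differentiable_def)
  have dF: "(F b has_derivative frechet_derivative (F b) (at x)) (at x)" for b
    using smooth_on_has_derivative[OF S(1) smooth_on_frechet_derivative[OF f] S(2)] by (simp add: F_def[abs_def])
  have *: "((\<lambda>x. frechet_derivative f (at x) (u x)) has_derivative
      (\<lambda>v. (\<Sum>b\<in>Basis. (u x \<bullet> b) *\<^sub>R frechet_derivative (F b) (at x) v) + frechet_derivative f (at x) (u' v))) (at x)"
    if u: "(u has_derivative u') (at x)" for u u'
  proof -
    have "((\<lambda>x. \<Sum>b\<in>Basis. (u x \<bullet> b) *\<^sub>R F b x) has_derivative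
      (\<lambda>v. \<Sum>b\<in>Basis. (u x \<bullet> b) *\<^sub>R frechet_derivative (F b) (at x) v + (u' v \<bullet> b) *\<^sub>R F b x)) (at x)"
      by (intro has_derivative_sum has_derivative_scaleR has_derivative_inner_left u dF)
    from has_derivative_transform_within_open[OF this S] show ?thesis
      by (simp add: sum sum.distrib S(2))
  qed
  have "frechet_derivative (\<lambda>x. frechet_derivative f (at x) w) (at x) =
      (\<lambda>v. \<Sum>b\<in>Basis. (y x \<bullet> b) *\<^sub>R frechet_derivative (F b) (at x) v)"
    using frechet_derivative_at[OF *[OF has_derivative_const[of "y x"]]]
    by (simp add: sum[OF S(2)] w)
  then show ?thesis
    using *[OF y] by simp
qed

section \<open>Tangent vectors of the projective space and their horizontal lifts\<close>

lemma vector_4_nth [simp]: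
  "(vector [w, x, y, z] :: 'a::zero ^ 4) $ 1 = w"
  "(vector [w, x, y, z] :: 'a::zero ^ 4) $ 2 = x"
  "(vector [w, x, y, z] :: 'a::zero ^ 4) $ 3 = y"
  "(vector [w, x, y, z] :: 'a::zero ^ 4) $ 4 = z"
  unfolding vector_def by simp_all

lemma linear_mult_i: "linear mult_i" and linear_mult_j: "linear mult_j" and linear_mult_k: "linear mult_k"
  by (auto intro!: linearI simp: mult_i_def mult_j_def mult_k_def vec_eq_iff forall_4 scaleR_complex.ctr
      complex_eq_iff algebra_simps)

lemmas bounded_linear_mult_i = linear_conv_bounded_linear[THEN iffD1, OF linear_mult_i]
lemmas bounded_linear_mult_j = linear_conv_bounded_linear[THEN iffD1, OF linear_mult_j]
lemmas bounded_linear_mult_k = linear_conv_bounded_linear[THEN iffD1, OF linear_mult_k]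

lemmas mult_ijk_linear =
  linear_add[OF linear_mult_i] linear_add[OF linear_mult_j] linear_add[OF linear_mult_k]
  linear_diff[OF linear_mult_i] linear_diff[OF linear_mult_j] linear_diff[OF linear_mult_k]
  linear_neg[OF linear_mult_i] linear_neg[OF linear_mult_j] linear_neg[OF linear_mult_k]
  linear_cmul[OF linear_mult_i] linear_cmul[OF linear_mult_j] linear_cmul[OF linear_mult_k]
  linear_0[OF linear_mult_i] linear_0[OF linear_mult_j] linear_0[OF linear_mult_k]

lemma mult_ijk_mult:
  "mult_i (mult_i q) = - q" "mult_j (mult_j q) = - q" "mult_k (mult_k q) = - q"
  "mult_i (mult_j q) = mult_k q" "mult_j (mult_i q) = - mult_k q"
  "mult_j (mult_k q) = mult_i q" "mult_k (mult_j q) = - mult_i q"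
  "mult_k (mult_i q) = mult_j q" "mult_i (mult_k q) = - mult_j q"
  by (simp_all add: mult_i_def mult_j_def mult_k_def vec_eq_iff forall_4 complex_eq_iff)

lemma mult_ijk_inner:
  "mult_i x \<bullet> y = - (x \<bullet> mult_i y)" "mult_j x \<bullet> y = - (x \<bullet> mult_j y)" "mult_k x \<bullet> y = - (x \<bullet> mult_k y)"
  by (simp_all add: mult_i_def mult_j_def mult_k_def inner_vec_def sum_4 inner_complex_def algebra_simps)

lemma mult_ijk_inner_self: "x \<bullet> mult_i x = 0" "x \<bullet> mult_j x = 0" "x \<bullet> mult_k x = 0"
  using mult_ijk_inner[of x x] by (simp_all add: inner_commute)

lemma inner_mult_ijk_commute:
  "x \<bullet> mult_i y = - (y \<bullet> mult_i x)" "x \<bullet> mult_j y = - (y \<bullet> mult_j x)" "x \<bullet> mult_k y = - (y \<bullet> mult_k x)"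
  by (metis inner_commute mult_ijk_inner)+

lemmas quaternion_simps = mult_ijk_linear mult_ijk_mult mult_ijk_inner mult_ijk_inner_self

lemma scale_eq: "c *s v = Re c *\<^sub>R v + Im c *\<^sub>R mult_i v"
  by (simp add: mult_i_def vec_eq_iff complex_eq_iff)

section \<open>Complex scaling and the fibres of the projection\<close>

lemma bounded_linear_scale: "bounded_linear (\<lambda>q::complex^4. c *s q)"
  unfolding scale_eq
  by (intro bounded_linear_add bounded_linear_const_scaleR bounded_linear_ident bounded_linear_mult_i)

lemma add_scale: "q + t *\<^sub>R (c *s q) = (1 + of_real t * c) *s (q :: complex^4)"
  by (simp add: scale_eq algebra_simps)

lemma scale_eq_0_iff: "c *s (v :: complex^4) = 0 \<longleftrightarrow> c = 0 \<or> v = 0"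
  by (rule vector_mul_eq_0)

lemma inner_scale: "(c *s u) \<bullet> (c *s (v :: complex^4)) = ((Re c)\<^sup>2 + (Im c)\<^sup>2) * (u \<bullet> v)"
  by (simp add: scale_eq inner_simps quaternion_simps power2_eq_square algebra_simps)

lemma range_scale:
  assumes "c \<noteq> 0"
  shows "range (\<lambda>d. d *s (c *s (z :: complex^4))) = range (\<lambda>d. d *s z)"
proof -
  have "range (\<lambda>d. d *s (c *s z)) = (\<lambda>d. d *s z) ` range (\<lambda>d. d * c)"
    by (simp add: image_image)
  also have "range (\<lambda>d. d * c) = UNIV"
    using assms by (intro surjI[of _ "\<lambda>d. d / c"]) simp
  finally show ?thesis .
qed

lemma proj_scale: "c \<noteq> 0 \<Longrightarrow> proj (c *s z) = proj z"
  unfolding proj_def by (rule arg_cong[OF range_scale])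

lemma proj_eqD:
  assumes "proj z = proj w" "z \<noteq> 0" "w \<noteq> 0"
  obtains c where "c \<noteq> 0" "w = c *s z"
proof -
  have "range (\<lambda>c. c *s z) = range (\<lambda>c. c *s w)"
    using assms unfolding proj_def by (subst (asm) Abs_cp3_inject) auto
  then have "1 *s w \<in> range (\<lambda>c. c *s z)"
    by blast
  then obtain c where "w = c *s z"
    by auto
  with assms(3) show thesis
    by (intro that[of c]) auto
qed

lemma proj_surj:
  obtains q where "q \<in> sphere 0 1" "q \<noteq> 0" "proj q = p"
proof -
  obtain z :: "complex^4" where z: "z \<noteq> 0" "Rep_cp3 p = range (\<lambda>c. c *s z)"
    using Rep_cp3[of p] by blast
  then have p: "proj z = p"
    by (metis Rep_cp3_inverse proj_def)
  define r where "r = inverse (norm z)"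
  define q where "q = complex_of_real r *s z"
  have "q = r *\<^sub>R z"
    by (simp add: q_def scale_eq)
  then have "norm q = 1"
    using z by (simp add: r_def)
  moreover have "proj q = p"
    unfolding q_def using z p by (subst proj_scale) (auto simp: r_def)
  ultimately show thesis
    using that[of q] by (metis mem_sphere_0 norm_zero zero_neq_one)
qed

lemma sphere_nonzero: "q \<in> sphere 0 1 \<Longrightarrow> (q :: 'a::real_normed_vector) \<noteq> 0"
  by auto

lemma sphere_inner: "q \<in> sphere 0 1 \<Longrightarrow> q \<bullet> q = (1::real)"
  by (simp add: dot_square_norm)

lemma open_punctured: "open (- {0 :: complex^4})"
  by auto

lemmas smooth_intros = smooth_on_add[OF open_punctured] smooth_on_diff[OF open_punctured]
  smooth_on_scaleR[OF open_punctured] smooth_on_inner[OF open_punctured] smooth_on_mult[OF open_punctured]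
  smooth_on_divide[OF open_punctured] smooth_on_const smooth_on_ident[OF open_punctured]
  smooth_on_bounded_linear[OF open_punctured bounded_linear_mult_i]
  smooth_on_bounded_linear[OF open_punctured bounded_linear_mult_j]
  smooth_on_bounded_linear[OF open_punctured bounded_linear_mult_k]

lemmas mult_ijk_derivative [derivative_intros] =
  bounded_linear.has_derivative[OF bounded_linear_mult_i]
  bounded_linear.has_derivative[OF bounded_linear_mult_j]
  bounded_linear.has_derivative[OF bounded_linear_mult_k]

section \<open>The differential of the projection on C^4 - {0}\<close>

lemma smooth_fun_iff: "smooth_fun f \<longleftrightarrow> smooth_on (- {0}) (f \<circ> proj)"
  by (simp add: smooth_fun_def smooth_on_def)

lemma smooth_fun_has_derivative:
  "smooth_fun f \<Longrightarrow> q \<noteq> 0 \<Longrightarrow>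
    ((f \<circ> proj) has_derivative frechet_derivative (f \<circ> proj) (at q)) (at q)"
  using smooth_on_has_derivative[OF open_punctured] by (auto simp: smooth_fun_iff)

lemma has_derivative_dproj:
  "smooth_fun f \<Longrightarrow> q \<noteq> 0 \<Longrightarrow> ((f \<circ> proj) has_derivative (\<lambda>v. dproj q v f)) (at q)"
  using smooth_fun_has_derivative by (simp add: dproj_def)

lemma dproj_nonsmooth: "\<not> smooth_fun f \<Longrightarrow> dproj q v f = 0"
  by (simp add: dproj_def)

lemma dproj_eqI: "smooth_fun f \<Longrightarrow> ((f \<circ> proj) has_derivative D) (at q) \<Longrightarrow> dproj q v f = D v"
  by (metis dproj_def frechet_derivative_at)

lemma linear_dproj: "q \<noteq> 0 \<Longrightarrow> linear (dproj q)"
proof (rule linearI)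
  fix u v :: "complex^4" and r :: real
  assume q: "q \<noteq> 0"
  have "dproj q (u + v) f = dproj q u f + dproj q v f \<and> dproj q (r *\<^sub>R u) f = r * dproj q u f" for f
    using has_derivative_linear[OF has_derivative_dproj[OF _ q, of f]]
    by (cases "smooth_fun f") (auto simp: dproj_nonsmooth linear_iff)
  then show "dproj q (u + v) = dproj q u + dproj q v" "dproj q (r *\<^sub>R u) = r *\<^sub>R dproj q u"
    by (auto simp: fun_eq_iff scaleR_fun_def)
qed

lemma dproj_scale:
  assumes "c \<noteq> 0" "q \<noteq> 0"
  shows "dproj (c *s q) (c *s v) = dproj q v"
proof
  fix f
  show "dproj (c *s q) (c *s v) f = dproj q v f"
  proof (cases "smooth_fun f")
    case True
    have "((\<lambda>q. (f \<circ> proj) (c *s q)) has_derivative (\<lambda>v. dproj (c *s q) (c *s v) f)) (at q)"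
      by (rule has_derivative_compose[OF bounded_linear_imp_has_derivative[OF bounded_linear_scale]
            has_derivative_dproj[OF True]])
         (use assms in \<open>simp add: scale_eq_0_iff\<close>)
    then have "((f \<circ> proj) has_derivative (\<lambda>v. dproj (c *s q) (c *s v) f)) (at q)"
      by (simp add: proj_scale[OF assms(1)] o_def)
    from dproj_eqI[OF True this, of v] show ?thesis
      by simp
  qed (simp add: dproj_nonsmooth)
qed

text \<open>By \<open>add_scale\<close>, moving from q along cq multiplies q by 1 + tc. The bound on
  t keeps this factor invertible, so the curve avoids 0 and stays over one point.\<close>

lemma one_plus_nonzero:
  fixes c :: complex
  assumes "t \<in> ball 0 (inverse (norm c + 1))"
  shows "1 + of_real t * c \<noteq> 0"
proof -
  have "norm (of_real t * c) \<le> \<bar>t\<bar> * (norm c + 1)"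
    by (simp add: norm_mult mult_left_mono)
  also have "\<dots> < inverse (norm c + 1) * (norm c + 1)"
    using assms by (intro mult_strict_right_mono) (auto simp: add_nonneg_pos)
  also have "\<dots> = 1"
    using norm_ge_zero[of c] by (intro left_inverse) linarith
  finally show ?thesis
    by (metis add_eq_0_iff norm_minus_cancel norm_one order_less_irrefl)
qed

text \<open>\<open>proj\<close> is constant along q + t cq for small t; c = 1 and c = i give the two
  directions of the fibre in C^4 - {0}.\<close>

lemma dproj_vertical:
  assumes "q \<noteq> 0"
  shows "dproj q q = 0" "dproj q (mult_i q) = 0"
proof -
  have *: "dproj q (c *s q) f = 0" for c f
  proof (cases "smooth_fun f")
    case True
    have 1: "((\<lambda>t::real. q + t *\<^sub>R (c *s q)) has_derivative (\<lambda>t. t *\<^sub>R (c *s q))) (at 0)"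
      by (auto intro!: derivative_eq_intros)
    have 2: "((f \<circ> proj) has_derivative (\<lambda>v. dproj q v f)) (at (q + (0::real) *\<^sub>R (c *s q)))"
      using has_derivative_dproj[OF True assms] by simp
    have 3: "((\<lambda>t::real. (f \<circ> proj) (q + t *\<^sub>R (c *s q))) has_derivative
        (\<lambda>t. dproj q (t *\<^sub>R (c *s q)) f)) (at 0)"
      using has_derivative_compose[OF 1 2] .
    have 4: "(f \<circ> proj) (q + t *\<^sub>R (c *s q)) = (f \<circ> proj) q"
      if "t \<in> ball 0 (inverse (norm c + 1))" for t
      by (simp only: comp_apply add_scale proj_scale[OF one_plus_nonzero[OF that]])
    have "((\<lambda>t::real. (f \<circ> proj) q) has_derivative (\<lambda>t. dproj q (t *\<^sub>R (c *s q)) f)) (at 0)"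
      by (rule has_derivative_transform_within_open[OF 3 open_ball[of 0 "inverse (norm c + 1)"] _ 4]) (auto simp: add_nonneg_pos)
    then have "(\<lambda>t::real. dproj q (t *\<^sub>R (c *s q)) f) = (\<lambda>t. 0)"
      using has_derivative_const has_derivative_unique by blast
    from fun_cong[OF this, of 1] show ?thesis
      by simp
  qed (simp add: dproj_nonsmooth)
  show "dproj q q = 0"
    using *[of 1] by (auto simp: fun_eq_iff)
  show "dproj q (mult_i q) = 0"
    using *[of \<i>] by (auto simp: fun_eq_iff mult_i_def)
qed

text \<open>The real inner product of b with z z^* c / |z|^2; the terms with \<open>mult_i\<close>
  make it independent of the phase of z.\<close>

definition hermitian_entry0 :: "complex^4 \<Rightarrow> complex^4 \<Rightarrow> complex^4 \<Rightarrow> real"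
  where "hermitian_entry0 b c z = ((b \<bullet> z) * (c \<bullet> z) + (b \<bullet> mult_i z) * (c \<bullet> mult_i z)) / (z \<bullet> z)"

definition hermitian_entry :: "complex^4 \<Rightarrow> complex^4 \<Rightarrow> cp3 \<Rightarrow> real"
  where "hermitian_entry b c p = hermitian_entry0 b c (SOME z. z \<noteq> 0 \<and> proj z = p)"

lemma hermitian_entry0_scale:
  assumes "d \<noteq> 0"
  shows "hermitian_entry0 b c (d *s z) = hermitian_entry0 b c z"
proof -
  define n where "n = (Re d)\<^sup>2 + (Im d)\<^sup>2"
  have "n \<noteq> 0"
    using assms by (simp add: n_def complex_eq_iff sum_power2_eq_zero_iff)
  moreover have "(b \<bullet> (d *s z)) * (c \<bullet> (d *s z)) + (b \<bullet> mult_i (d *s z)) * (c \<bullet> mult_i (d *s z)) =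
      n * ((b \<bullet> z) * (c \<bullet> z) + (b \<bullet> mult_i z) * (c \<bullet> mult_i z))"
    by (simp add: scale_eq quaternion_simps inner_simps n_def) algebra
  ultimately show ?thesis
    unfolding hermitian_entry0_def by (simp add: inner_scale flip: n_def)
qed

lemma some_proj:
  assumes "z \<noteq> 0"
  obtains c where "c \<noteq> 0" "(SOME w. w \<noteq> 0 \<and> proj w = proj z) = c *s z"
proof -
  define w where "w = (SOME w. w \<noteq> 0 \<and> proj w = proj z)"
  have "w \<noteq> 0 \<and> proj w = proj z"
    unfolding w_def by (rule someI[of _ z]) (use assms in simp)
  then show thesis
    using proj_eqD[of z w] assms that unfolding w_def by metis
qed

lemma hermitian_entry_proj: "z \<noteq> 0 \<Longrightarrow> hermitian_entry b c (proj z) = hermitian_entry0 b c z"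
  unfolding hermitian_entry_def by (rule some_proj[of z]) (simp_all add: hermitian_entry0_scale)

lemma smooth_hermitian_entry: "smooth_fun (hermitian_entry b c)"
  unfolding smooth_fun_iff
proof (rule smooth_on_cong[OF open_punctured])
  show "smooth_on (- {0}) (hermitian_entry0 b c)"
    unfolding hermitian_entry0_def
    by (intro smooth_intros) auto
qed (simp add: hermitian_entry_proj)

section \<open>Horizontal vectors and their recovery from derivations\<close>

definition horz :: "complex^4 \<Rightarrow> complex^4 \<Rightarrow> bool"
  where "horz q v \<longleftrightarrow> v \<bullet> q = 0 \<and> v \<bullet> mult_i q = 0"

lemma horz_simps:
  assumes "horz q v"
  shows "v \<bullet> q = 0" "v \<bullet> mult_i q = 0" "q \<bullet> v = 0" "q \<bullet> mult_i v = 0"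
  using assms inner_mult_ijk_commute(1)[of q v] by (simp_all add: horz_def inner_commute)

lemma horizontal_iff: "v \<in> horizontal q \<longleftrightarrow> horz q v"
  by (simp add: horizontal_def tangent_sphere_def horz_def)

lemma horz_scale: "horz q v \<Longrightarrow> horz (c *s q) (c *s v)"
  by (simp add: horz_def scale_eq inner_simps quaternion_simps)

definition hor :: "complex^4 \<Rightarrow> complex^4 \<Rightarrow> complex^4"
  where "hor q v = v - ((v \<bullet> q) / (q \<bullet> q)) *\<^sub>R q - ((v \<bullet> mult_i q) / (q \<bullet> q)) *\<^sub>R mult_i q"

lemma horz_hor: "q \<noteq> 0 \<Longrightarrow> horz q (hor q v)"
  by (simp add: horz_def hor_def inner_simps quaternion_simps)

lemma dproj_hor: "q \<noteq> 0 \<Longrightarrow> dproj q (hor q v) = dproj q v"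
  by (simp add: hor_def linear_diff[OF linear_dproj] linear_cmul[OF linear_dproj] dproj_vertical)

text \<open>Since q . v = 0, the denominator is stationary along v and only the numerator is
  differentiated.\<close>

lemma dproj_hermitian_entry:
  assumes "q \<noteq> 0" "horz q v"
  shows "dproj q v (hermitian_entry b c) = ((b \<bullet> v) * (c \<bullet> q) + (b \<bullet> q) * (c \<bullet> v) +
    (b \<bullet> mult_i v) * (c \<bullet> mult_i q) + (b \<bullet> mult_i q) * (c \<bullet> mult_i v)) / (q \<bullet> q)"
proof -
  have 1: "((\<lambda>z. (b \<bullet> z) * (c \<bullet> z) + (b \<bullet> mult_i z) * (c \<bullet> mult_i z)) has_derivative
      (\<lambda>v. (b \<bullet> v) * (c \<bullet> q) + (b \<bullet> q) * (c \<bullet> v) +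
        (b \<bullet> mult_i v) * (c \<bullet> mult_i q) + (b \<bullet> mult_i q) * (c \<bullet> mult_i v))) (at q)"
    by (auto intro!: derivative_eq_intros bounded_linear.has_derivative[OF bounded_linear_mult_i])
  have 2: "((\<lambda>z. z \<bullet> z) has_derivative (\<lambda>v. 2 * (q \<bullet> v))) (at q)"
    by (auto intro!: derivative_eq_intros simp: inner_commute)
  have "(hermitian_entry0 b c has_derivative (\<lambda>v. (((b \<bullet> v) * (c \<bullet> q) + (b \<bullet> q) * (c \<bullet> v) +
    (b \<bullet> mult_i v) * (c \<bullet> mult_i q) + (b \<bullet> mult_i q) * (c \<bullet> mult_i v)) * (q \<bullet> q) -
     ((b \<bullet> q) * (c \<bullet> q) + (b \<bullet> mult_i q) * (c \<bullet> mult_i q)) * (2 * (q \<bullet> v))) / ((q \<bullet> q) * (q \<bullet> q)))) (at q)"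
    unfolding hermitian_entry0_def using has_derivative_divide'[OF 1 2] assms by simp
  then have "((hermitian_entry b c \<circ> proj) has_derivative (\<lambda>v. (((b \<bullet> v) * (c \<bullet> q) + (b \<bullet> q) * (c \<bullet> v) +
    (b \<bullet> mult_i v) * (c \<bullet> mult_i q) + (b \<bullet> mult_i q) * (c \<bullet> mult_i v)) * (q \<bullet> q) -
     ((b \<bullet> q) * (c \<bullet> q) + (b \<bullet> mult_i q) * (c \<bullet> mult_i q)) * (2 * (q \<bullet> v))) / ((q \<bullet> q) * (q \<bullet> q)))) (at q)"
    by (rule has_derivative_transform_within_open[OF _ open_punctured]) (use assms in \<open>auto simp: hermitian_entry_proj\<close>)
  from dproj_eqI[OF smooth_hermitian_entry this, of v] show ?thesis
    using assms by (simp add: horz_simps)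
qed

lemma euclidean_inner_sum: "(\<Sum>c\<in>Basis. (c \<bullet> u) * (c \<bullet> v)) = u \<bullet> (v :: 'a::euclidean_space)"
  by (subst euclidean_inner[of u v]) (simp add: inner_commute)

text \<open>With \<open>hermitian_entry b c\<close> the matrix entries of the embedding \<open>z \<mapsto> z z\<^sup>* / \<bar>z\<bar>\<^sup>2\<close> of \<open>\<complex>P\<^sup>3\<close> into the Hermitian
  matrices, the horizontal lift of \<open>u\<close> at \<open>q\<close> is the matrix \<open>u (z z\<^sup>* / \<bar>z\<bar>\<^sup>2)\<close> applied to \<open>q\<close>.\<close>

definition lift :: "vfield \<Rightarrow> complex^4 \<Rightarrow> complex^4"
  where "lift X q = (\<Sum>b\<in>Basis. (\<Sum>c\<in>Basis. X (proj q) (hermitian_entry b c) * (c \<bullet> q)) *\<^sub>R b)"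

text \<open>Contracting c with q over the orthonormal basis turns the four products of
  \<open>dproj_hermitian_entry\<close> into q . q, v . q, iq . q and iv . q; only the first is
  nonzero.\<close>

lemma lift_eq:
  assumes "q \<noteq> 0" "horz q v" "X (proj q) = dproj q v"
  shows "lift X q = v"
proof -
  have "(\<Sum>c\<in>Basis. X (proj q) (hermitian_entry b c) * (c \<bullet> q)) = v \<bullet> b" for b
  proof -
    have "(\<Sum>c\<in>Basis. X (proj q) (hermitian_entry b c) * (c \<bullet> q)) =
      ((b \<bullet> v) * (\<Sum>c\<in>Basis. (c \<bullet> q) * (c \<bullet> q)) + (b \<bullet> q) * (\<Sum>c\<in>Basis. (c \<bullet> v) * (c \<bullet> q)) +
      (b \<bullet> mult_i v) * (\<Sum>c\<in>Basis. (c \<bullet> mult_i q) * (c \<bullet> q)) +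
      (b \<bullet> mult_i q) * (\<Sum>c\<in>Basis. (c \<bullet> mult_i v) * (c \<bullet> q))) / (q \<bullet> q)"
      unfolding assms(3) dproj_hermitian_entry[OF assms(1,2)]
      by (simp add: sum_distrib_left sum_distrib_right sum_divide_distrib sum.distrib[symmetric]
          algebra_simps add_divide_distrib)
    also have "\<dots> = v \<bullet> b"
      unfolding euclidean_inner_sum using assms
      by (simp add: horz_simps quaternion_simps inner_commute)
    finally show ?thesis .
  qed
  then show ?thesis
    by (simp add: lift_def euclidean_representation)
qed

text \<open>\<open>lift\<close> is a left inverse of \<open>dproj\<close> on horizontal vectors, and
  its value at q depends on the tangent vector at \<open>proj q\<close> only.\<close>

lemma dproj_inj: "q \<noteq> 0 \<Longrightarrow> horz q u \<Longrightarrow> horz q v \<Longrightarrow> dproj q u = dproj q v \<Longrightarrow> u = v"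
  by (metis lift_eq[of q _ "\<lambda>_. dproj q v"])

section \<open>Vector fields as equivariant horizontal fields\<close>

definition equivariant :: "(complex^4 \<Rightarrow> complex^4) \<Rightarrow> bool"
  where "equivariant x \<longleftrightarrow> (\<forall>c q. c \<noteq> 0 \<longrightarrow> q \<noteq> 0 \<longrightarrow> x (c *s q) = c *s x q)"

definition hfield :: "(complex^4 \<Rightarrow> complex^4) \<Rightarrow> bool"
  where "hfield x \<longleftrightarrow> smooth_on (- {0}) x \<and> equivariant x \<and> (\<forall>q. q \<noteq> 0 \<longrightarrow> horz q (x q))"

definition down :: "(complex^4 \<Rightarrow> complex^4) \<Rightarrow> vfield"
  where "down x p = (let q = SOME q. q \<noteq> 0 \<and> proj q = p in dproj q (x q))"

lemma down_proj: "equivariant x \<Longrightarrow> q \<noteq> 0 \<Longrightarrow> down x (proj q) = dproj q (x q)"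
  unfolding down_def Let_def by (rule some_proj[of q]) (simp_all add: equivariant_def dproj_scale)

text \<open>The definition ranges over all unit vectors of a fibre; this fixes one q of any norm.
  Rescaling passes between representatives, and \<open>hor\<close> removes the vertical part without
  changing the derivation.\<close>

lemma tangent_space_iff:
  assumes "q \<noteq> 0"
  shows "u \<in> tangent_space (proj q) \<longleftrightarrow> (\<exists>v. horz q v \<and> u = dproj q v)"
proof
  assume "u \<in> tangent_space (proj q)"
  then obtain q' v where q': "q' \<in> sphere 0 1" "proj q' = proj q" "u = dproj q' v"
    by (auto simp: tangent_space_def)
  obtain c where "c \<noteq> 0" "q = c *s q'"
    using proj_eqD[OF q'(2) sphere_nonzero[OF q'(1)] assms] .
  then have "u = dproj q (hor q (c *s v))"
    using q' assms by (simp add: dproj_hor dproj_scale scale_eq_0_iff)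
  then show "\<exists>v. horz q v \<and> u = dproj q v"
    using horz_hor[OF assms] by blast
next
  assume "\<exists>v. horz q v \<and> u = dproj q v"
  then obtain v where v: "horz q v" "u = dproj q v"
    by blast
  obtain q' where q': "q' \<in> sphere 0 1" "proj q' = proj q"
    using proj_surj by metis
  obtain c where "c \<noteq> 0" "q' = c *s q"
    using proj_eqD[OF q'(2)[symmetric] assms sphere_nonzero[OF q'(1)]] .
  then have "u = dproj q' (c *s v)" "horz q' (c *s v)"
    using v assms by (auto simp: dproj_scale horz_scale)
  then show "u \<in> tangent_space (proj q)"
    using q' unfolding tangent_space_def tangent_sphere_def horz_def by blast
qed

lemma lift_tangent:
  assumes "X \<in> vector_fields" "q \<noteq> 0"
  shows "horz q (lift X q)" "dproj q (lift X q) = X (proj q)"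
proof -
  obtain v where "horz q v" "X (proj q) = dproj q v"
    using assms(1) tangent_space_iff[OF assms(2), of "X (proj q)"] by (auto simp: vector_fields_def)
  then show "horz q (lift X q)" "dproj q (lift X q) = X (proj q)"
    using lift_eq[OF assms(2)] by simp_all
qed

text \<open>Smoothness is read off the formula of \<open>lift\<close>, whose coefficients are smooth
  functions on projective space; equivariance is uniqueness of horizontal lifts.\<close>

lemma hfield_lift:
  assumes "X \<in> vector_fields"
  shows "hfield (lift X)"
  unfolding hfield_def equivariant_def
proof (intro conjI allI impI)
  have "smooth_on (- {0}) (\<lambda>q. X (proj q) (hermitian_entry b c))" for b c
    using assms smooth_hermitian_entry[of b c] by (auto simp: vector_fields_def smooth_fun_iff o_def deriv_along_def)
  then show "smooth_on (- {0}) (lift X)"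
    unfolding lift_def
    by (intro smooth_on_sum smooth_intros open_punctured)
next
  fix q :: "complex^4"
  assume "q \<noteq> 0"
  then show "horz q (lift X q)"
    by (rule lift_tangent[OF assms])
next
  fix q :: "complex^4" and c :: complex
  assume "c \<noteq> 0" "q \<noteq> 0"
  then show "lift X (c *s q) = c *s lift X q"
    using lift_tangent[OF assms, of q]
    by (intro lift_eq) (auto simp: scale_eq_0_iff proj_scale dproj_scale horz_scale)
qed

lemma lift_down: "hfield x \<Longrightarrow> q \<noteq> 0 \<Longrightarrow> lift (down x) q = x q"
  by (intro lift_eq) (auto simp: hfield_def down_proj)

lemma down_vector_fields:
  assumes "smooth_on (- {0}) x" "equivariant x"
  shows "down x \<in> vector_fields"
  unfolding vector_fields_def
proof (intro CollectI conjI allI impI)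
  fix p
  obtain q where "q \<noteq> 0" "proj q = p"
    using proj_surj by metis
  then show "down x p \<in> tangent_space p"
    using down_proj[OF assms(2), of q] dproj_hor horz_hor tangent_space_iff by metis
next
  fix f
  assume f: "smooth_fun f"
  show "smooth_fun (deriv_along (down x) f)"
    unfolding smooth_fun_iff
  proof (rule smooth_on_cong[OF open_punctured])
    show "smooth_on (- {0}) (\<lambda>q. frechet_derivative (f \<circ> proj) (at q) (x q))"
      using f assms(1) by (intro smooth_on_frechet_derivative_along open_punctured) (auto simp: smooth_fun_iff)
  qed (use f assms in \<open>auto simp: deriv_along_def down_proj dproj_def\<close>)
qed

section \<open>The tensors on horizontal lifts\<close>

text \<open>Behind the well-definedness of \<open>g1\<close>, \<open>J1\<close>, \<open>D1\<close>
  and \<open>D2\<close>: unit points of one fibre differ by a phase c, and by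
  \<open>dproj_inj\<close> the horizontal lifts of one tangent vector differ by the same c.\<close>

lemma fibre:
  assumes "q \<in> sphere 0 1" "q' \<in> sphere 0 1" "proj q' = proj q"
  obtains c where "(Re c)\<^sup>2 + (Im c)\<^sup>2 = 1" "q' = c *s q"
    "\<And>x x'. horz q x \<Longrightarrow> horz q' x' \<Longrightarrow> dproj q' x' = dproj q x \<Longrightarrow> x' = c *s x"
proof -
  obtain c where c: "c \<noteq> 0" "q' = c *s q"
    using proj_eqD[OF assms(3)[symmetric] sphere_nonzero[OF assms(1)] sphere_nonzero[OF assms(2)]] .
  then have "(Re c)\<^sup>2 + (Im c)\<^sup>2 = 1"
    using inner_scale[of c q q] sphere_inner[OF assms(1)] sphere_inner[OF assms(2)] by simp
  moreover have "x' = c *s x" if "horz q x" "horz q' x'" "dproj q' x' = dproj q x" for x x'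
    using dproj_inj[OF sphere_nonzero[OF assms(2)] that(2)] horz_scale[OF that(1), of c] that c
      dproj_scale[OF c(1) sphere_nonzero[OF assms(1)], of x] by metis
  ultimately show thesis
    using that c by blast
qed

lemma g1_dproj:
  assumes "q \<in> sphere 0 1" "horz q x" "horz q y"
  shows "g1 (proj q) (dproj q x) (dproj q y) = x \<bullet> y"
  unfolding g1_def
proof (rule the_equality)
  show "\<forall>q'\<in>sphere 0 1. \<forall>x'\<in>horizontal q'. \<forall>y'\<in>horizontal q'.
    proj q' = proj q \<and> dproj q' x' = dproj q x \<and> dproj q' y' = dproj q y \<longrightarrow> x \<bullet> y = x' \<bullet> y'"
  proof (intro ballI impI)
    fix q' x' y'
    assume *: "q' \<in> sphere 0 1" "x' \<in> horizontal q'" "y' \<in> horizontal q'"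
      "proj q' = proj q \<and> dproj q' x' = dproj q x \<and> dproj q' y' = dproj q y"
    obtain c where c: "(Re c)\<^sup>2 + (Im c)\<^sup>2 = 1" "q' = c *s q"
      "\<And>x x'. horz q x \<Longrightarrow> horz q' x' \<Longrightarrow> dproj q' x' = dproj q x \<Longrightarrow> x' = c *s x"
      using fibre[OF assms(1) *(1)] * by metis
    show "x \<bullet> y = x' \<bullet> y'"
      using c(3)[of x x'] c(3)[of y y'] c(1) * assms by (simp add: inner_scale horizontal_iff)
  qed
qed (use assms in \<open>auto simp: horizontal_iff\<close>)

lemma horz_mult_i: "horz q x \<Longrightarrow> horz q (mult_i x)"
  by (simp add: horz_def quaternion_simps)

lemma mult_i_scale: "mult_i (c *s x) = c *s mult_i x"
  by (simp add: scale_eq quaternion_simps)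

lemma J1_dproj:
  assumes "q \<in> sphere 0 1" "horz q x"
  shows "J1 (proj q) (dproj q x) = dproj q (mult_i x)"
  unfolding J1_def
proof (rule the_equality)
  show "\<forall>q'\<in>sphere 0 1. \<forall>x'\<in>horizontal q'.
    proj q' = proj q \<and> dproj q' x' = dproj q x \<longrightarrow> dproj q (mult_i x) = dproj q' (mult_i x')"
  proof (intro ballI impI)
    fix q' x'
    assume *: "q' \<in> sphere 0 1" "x' \<in> horizontal q'" "proj q' = proj q \<and> dproj q' x' = dproj q x"
    obtain c where c: "(Re c)\<^sup>2 + (Im c)\<^sup>2 = 1" "q' = c *s q"
      "\<And>x x'. horz q x \<Longrightarrow> horz q' x' \<Longrightarrow> dproj q' x' = dproj q x \<Longrightarrow> x' = c *s x"
      using fibre[OF assms(1) *(1)] * by metis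
    have "c \<noteq> 0"
      using c(1) by auto
    then show "dproj q (mult_i x) = dproj q' (mult_i x')"
      using c(3)[of x x'] c(2) * assms
      by (simp add: horizontal_iff mult_i_scale dproj_scale sphere_nonzero)
  qed
qed (use assms in \<open>auto simp: horizontal_iff\<close>)

text \<open>For unit q, the orthogonal projection onto the span of jq and kq.\<close>

definition D1_part :: "complex^4 \<Rightarrow> complex^4 \<Rightarrow> complex^4"
  where "D1_part q x = (x \<bullet> mult_j q) *\<^sub>R mult_j q + (x \<bullet> mult_k q) *\<^sub>R mult_k q"

lemma horz_jk: "horz q (\<alpha> *\<^sub>R mult_j q + \<beta> *\<^sub>R mult_k q)"
  by (simp add: horz_def quaternion_simps inner_simps)

lemma D1_iff:
  assumes "q \<in> sphere 0 1"
  shows "u \<in> D1 (proj q) \<longleftrightarrow> (\<exists>\<alpha> \<beta>. u = dproj q (\<alpha> *\<^sub>R mult_j q + \<beta> *\<^sub>R mult_k q))"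
proof
  assume "u \<in> D1 (proj q)"
  then obtain q' v where *: "q' \<in> sphere 0 1" "proj q' = proj q" "v \<in> span {mult_j q', mult_k q'}" "u = dproj q' v"
    by (auto simp: D1_def)
  obtain c where c: "(Re c)\<^sup>2 + (Im c)\<^sup>2 = 1" "q' = c *s q"
    using fibre[OF assms *(1,2)] by metis
  obtain \<alpha> \<beta> where v: "v = \<alpha> *\<^sub>R mult_j q' + \<beta> *\<^sub>R mult_k q'"
    using *(3) by (auto simp: span_insert span_breakdown_eq algebra_simps)
  define r s where "r = Re c" and "s = Im c"
  \<comment> \<open>Since k = ij, v is (\<alpha> + i \<beta>) j(cq) = (\<alpha> + i \<beta>) cbar
    jq. As |c| = 1, pulling out c leaves the coefficient (\<alpha> + i \<beta>) cbar^2, whose real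
    and imaginary parts stand here.\<close>
  have "v = c *s ((r * (\<alpha> * r + \<beta> * s) + s * (\<beta> * r - \<alpha> * s)) *\<^sub>R mult_j q +
      (r * (\<beta> * r - \<alpha> * s) - s * (\<alpha> * r + \<beta> * s)) *\<^sub>R mult_k q)"
  proof -
    have "(r\<^sup>2 + s\<^sup>2) = 1"
      using c by (simp add: r_def s_def)
    then have 1: "\<alpha> * r + \<beta> * s = r * (r * (\<alpha> * r + \<beta> * s) + s * (\<beta> * r - \<alpha> * s)) -
        s * (r * (\<beta> * r - \<alpha> * s) - s * (\<alpha> * r + \<beta> * s))"
      "\<beta> * r - \<alpha> * s = s * (r * (\<alpha> * r + \<beta> * s) + s * (\<beta> * r - \<alpha> * s)) +
        r * (r * (\<beta> * r - \<alpha> * s) - s * (\<alpha> * r + \<beta> * s))"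
      by algebra+
    have "v = (\<alpha> * r + \<beta> * s) *\<^sub>R mult_j q + (\<beta> * r - \<alpha> * s) *\<^sub>R mult_k q"
      by (simp add: v c scale_eq quaternion_simps flip: r_def s_def) (simp add: algebra_simps)
    moreover have "c *s (A *\<^sub>R mult_j q + B *\<^sub>R mult_k q) =
        (r * A - s * B) *\<^sub>R mult_j q + (s * A + r * B) *\<^sub>R mult_k q" for A B
      by (simp add: scale_eq quaternion_simps algebra_simps flip: r_def s_def)
    ultimately show ?thesis
      using 1 by simp
  qed
  moreover have "c \<noteq> 0"
    using c by auto
  ultimately show "\<exists>\<alpha> \<beta>. u = dproj q (\<alpha> *\<^sub>R mult_j q + \<beta> *\<^sub>R mult_k q)"
    using *(4) c(2) dproj_scale[OF _ sphere_nonzero[OF assms]] by metis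
next
  assume "\<exists>\<alpha> \<beta>. u = dproj q (\<alpha> *\<^sub>R mult_j q + \<beta> *\<^sub>R mult_k q)"
  then obtain \<alpha> \<beta> where "u = dproj q (\<alpha> *\<^sub>R mult_j q + \<beta> *\<^sub>R mult_k q)"
    by blast
  moreover have "\<alpha> *\<^sub>R mult_j q + \<beta> *\<^sub>R mult_k q \<in> span {mult_j q, mult_k q}"
    by (intro span_add span_scale span_base) auto
  ultimately show "u \<in> D1 (proj q)"
    using assms unfolding D1_def by blast
qed

lemma D2_iff:
  assumes "q \<in> sphere 0 1"
  shows "u \<in> D2 (proj q) \<longleftrightarrow> (\<exists>v. horz q v \<and> v \<bullet> mult_j q = 0 \<and> v \<bullet> mult_k q = 0 \<and> u = dproj q v)"
proof
  assume "u \<in> D2 (proj q)"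
  then obtain q' v where *: "q' \<in> sphere 0 1" "proj q' = proj q" "horz q' v"
    "v \<bullet> mult_j q' = 0" "v \<bullet> mult_k q' = 0" "u = dproj q' v"
    by (auto simp: D2_def horz_def tangent_sphere_def)
  obtain c where c: "(Re c)\<^sup>2 + (Im c)\<^sup>2 = 1" "q' = c *s q"
    using fibre[OF assms *(1,2)] by metis
  then have "c \<noteq> 0"
    by auto
  then have q: "q = inverse c *s q'"
    by (simp add: c(2) vector_smult_assoc)
  have "inverse c \<noteq> 0" "q' \<noteq> 0"
    using \<open>c \<noteq> 0\<close> *(1) by auto
  then have "u = dproj q (inverse c *s v)"
    unfolding *(6) using dproj_scale[of "inverse c" q' v] q by simp
  moreover have "horz q (inverse c *s v)"
    using horz_scale[OF *(3), of "inverse c"] q by simp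
  moreover have "(inverse c *s v) \<bullet> mult_j q = 0" "(inverse c *s v) \<bullet> mult_k q = 0"
    using *(4,5) unfolding q by (simp_all add: scale_eq quaternion_simps inner_simps)
  ultimately show "\<exists>v. horz q v \<and> v \<bullet> mult_j q = 0 \<and> v \<bullet> mult_k q = 0 \<and> u = dproj q v"
    by blast
next
  assume "\<exists>v. horz q v \<and> v \<bullet> mult_j q = 0 \<and> v \<bullet> mult_k q = 0 \<and> u = dproj q v"
  then show "u \<in> D2 (proj q)"
    using assms unfolding D2_def horz_def tangent_sphere_def by blast
qed

lemma horz_add: "horz q u \<Longrightarrow> horz q v \<Longrightarrow> horz q (u + v)"
  and horz_diff: "horz q u \<Longrightarrow> horz q v \<Longrightarrow> horz q (u - v)"
  and horz_scaleR: "horz q u \<Longrightarrow> horz q (r *\<^sub>R u)"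
  by (simp_all add: horz_def inner_simps)

lemma horz_D1_part: "horz q (D1_part q x)"
  unfolding D1_part_def by (rule horz_jk)

lemma pr1_dproj:
  assumes q: "q \<in> sphere 0 1" and x: "horz q x"
  shows "pr1 (proj q) (dproj q x) = dproj q (D1_part q x)"
  unfolding pr1_def
proof (rule the_equality)
  note [simp] = sphere_inner[OF q] linear_diff[OF linear_dproj[OF sphere_nonzero[OF q]], symmetric]
  have "horz q (x - D1_part q x)" "(x - D1_part q x) \<bullet> mult_j q = 0" "(x - D1_part q x) \<bullet> mult_k q = 0"
    using horz_diff[OF x horz_D1_part] by (simp_all add: D1_part_def quaternion_simps inner_simps)
  then show "dproj q (D1_part q x) \<in> D1 (proj q) \<and> dproj q x - dproj q (D1_part q x) \<in> D2 (proj q)"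
    unfolding D1_iff[OF q] D2_iff[OF q] unfolding D1_part_def by auto
next
  fix u
  assume u: "u \<in> D1 (proj q) \<and> dproj q x - u \<in> D2 (proj q)"
  then obtain \<alpha> \<beta> where ab: "u = dproj q (\<alpha> *\<^sub>R mult_j q + \<beta> *\<^sub>R mult_k q)"
    unfolding D1_iff[OF q] by blast
  obtain v where v: "horz q v" "v \<bullet> mult_j q = 0" "v \<bullet> mult_k q = 0" "dproj q x - u = dproj q v"
    using u unfolding D2_iff[OF q] by blast
  have "dproj q x = dproj q (\<alpha> *\<^sub>R mult_j q + \<beta> *\<^sub>R mult_k q + v)"
    unfolding linear_add[OF linear_dproj[OF sphere_nonzero[OF q]]]
    using v(4) linear_add[OF linear_dproj[OF sphere_nonzero[OF q]]] by (simp add: ab algebra_simps)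
  then have "x = \<alpha> *\<^sub>R mult_j q + \<beta> *\<^sub>R mult_k q + v"
    using dproj_inj[OF sphere_nonzero[OF q] x] horz_add[OF horz_jk v(1)] by blast
  then show "u = dproj q (D1_part q x)"
    using v(2,3) by (simp add: ab D1_part_def inner_simps quaternion_simps sphere_inner[OF q])
qed

lemma pr2_dproj:
  assumes q: "q \<in> sphere 0 1" and x: "horz q x"
  shows "pr2 (proj q) (dproj q x) = dproj q (x - D1_part q x)"
  by (simp add: pr2_def pr1_dproj[OF assms] linear_diff[OF linear_dproj[OF sphere_nonzero[OF q]]])

text \<open>By orthogonality the \<open>D2\<close> parts pair to x . y minus the pairing of the
  \<open>D1\<close> parts; so x . y gets the weight a and 1 - a remains for the \<open>D1\<close>
  parts.\<close>

lemma ga_dproj_sphere: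
  assumes q: "q \<in> sphere 0 1" and "horz q x" "horz q y"
  shows "ga a (proj q) (dproj q x) (dproj q y) = a * (x \<bullet> y) +
    (1 - a) * ((x \<bullet> mult_j q) * (y \<bullet> mult_j q) + (x \<bullet> mult_k q) * (y \<bullet> mult_k q))"
  using assms
  by (simp add: ga_def pr1_dproj pr2_dproj g1_dproj horz_D1_part horz_diff)
     (simp add: D1_part_def inner_simps quaternion_simps sphere_inner algebra_simps inner_commute)

lemma J_dproj:
  assumes q: "q \<in> sphere 0 1" and x: "horz q x"
  shows "J (proj q) (dproj q x) = dproj q (mult_i x - 2 *\<^sub>R mult_i (D1_part q x))"
proof -
  note lin = linear_dproj[OF sphere_nonzero[OF q]]
  have "J (proj q) (dproj q x) = - dproj q (mult_i (D1_part q x)) + dproj q (mult_i (x - D1_part q x))"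
    using assms by (simp add: J_def pr1_dproj pr2_dproj J1_dproj horz_D1_part horz_diff)
  also have "\<dots> = dproj q (- mult_i (D1_part q x) + mult_i (x - D1_part q x))"
    by (simp only: linear_add[OF lin] linear_neg[OF lin])
  also have "- mult_i (D1_part q x) + mult_i (x - D1_part q x) = mult_i x - 2 *\<^sub>R mult_i (D1_part q x)"
    by (simp only: quaternion_simps scaleR_2) simp
  finally show ?thesis .
qed

lemma D1_part_mult_i: "D1_part q (mult_i x) = mult_i (D1_part q x)"
  by (simp add: D1_part_def quaternion_simps)

lemma P_dproj:
  assumes q: "q \<in> sphere 0 1" and x: "horz q x"
  shows "P (proj q) (dproj q x) = dproj q (x - 2 *\<^sub>R D1_part q x)"
  using assms
  by (simp add: P_def J1_dproj J_dproj horz_mult_i D1_part_mult_i quaternion_simps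
      linear_neg[OF linear_dproj[OF sphere_nonzero[OF q]], symmetric])

text \<open>The powers of q . q make the expression invariant under scaling q, x and y together, in
  accordance with \<open>dproj_scale\<close>. Differentiating the metric needs this extension off
  the unit sphere.\<close>

definition ga_lift :: "real \<Rightarrow> complex^4 \<Rightarrow> complex^4 \<Rightarrow> complex^4 \<Rightarrow> real"
  where "ga_lift a q x y = (a * (x \<bullet> y) + (1 - a) *
    ((x \<bullet> mult_j q) * (y \<bullet> mult_j q) + (x \<bullet> mult_k q) * (y \<bullet> mult_k q)) / (q \<bullet> q)) / (q \<bullet> q)"

lemma ga_dproj:
  assumes "q \<noteq> 0" and "horz q x" "horz q y"
  shows "ga a (proj q) (dproj q x) (dproj q y) = ga_lift a q x y"
proof -
  define r where "r = inverse (norm q)"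
  have r: "r > 0" "r * r = inverse (q \<bullet> q)"
    using assms(1) by (simp_all add: r_def dot_square_norm power2_eq_square)
  define c where "c = complex_of_real r"
  have c: "c \<noteq> 0" "\<And>v :: complex^4. c *s v = r *\<^sub>R v"
    using r by (simp_all add: c_def scale_eq)
  have "ga a (proj (c *s q)) (dproj (c *s q) (c *s x)) (dproj (c *s q) (c *s y)) = ga_lift a q x y"
  proof (subst ga_dproj_sphere)
    show "c *s q \<in> sphere 0 1"
      using assms(1) by (simp add: c(2) r_def)
    show "a * ((c *s x) \<bullet> (c *s y)) +
      (1 - a) * (((c *s x) \<bullet> mult_j (c *s q)) * ((c *s y) \<bullet> mult_j (c *s q)) +
        ((c *s x) \<bullet> mult_k (c *s q)) * ((c *s y) \<bullet> mult_k (c *s q))) = ga_lift a q x y"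
    proof -
      have "a * ((c *s x) \<bullet> (c *s y)) +
        (1 - a) * (((c *s x) \<bullet> mult_j (c *s q)) * ((c *s y) \<bullet> mult_j (c *s q)) +
          ((c *s x) \<bullet> mult_k (c *s q)) * ((c *s y) \<bullet> mult_k (c *s q))) =
        (r * r) * (a * (x \<bullet> y) + (1 - a) * ((x \<bullet> mult_j q) * (y \<bullet> mult_j q) +
          (x \<bullet> mult_k q) * (y \<bullet> mult_k q)) * (r * r))"
        by (simp add: c(2) quaternion_simps) algebra
      then show ?thesis
        by (simp add: r(2) ga_lift_def divide_inverse)
    qed
  qed (use assms horz_scale in blast)+
  then show ?thesis
    using dproj_scale[OF c(1) assms(1)] proj_scale[OF c(1)] by simp
qed

section \<open>A torsion-free connection\<close>

lemma hfieldD: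
  assumes "hfield x"
  shows "smooth_on (- {0}) x" "equivariant x" "\<And>q. q \<noteq> 0 \<Longrightarrow> horz q (x q)"
    "\<And>c q. c \<noteq> 0 \<Longrightarrow> q \<noteq> 0 \<Longrightarrow> x (c *s q) = c *s x q"
  using assms by (auto simp: hfield_def equivariant_def)

lemma hfield_has_derivative:
  "hfield z \<Longrightarrow> q \<noteq> 0 \<Longrightarrow> (z has_derivative frechet_derivative z (at q)) (at q)"
  using smooth_on_has_derivative[OF open_punctured hfieldD(1)] by auto

text \<open>Differentiating the identities z . q = 0 and z . iq = 0 shows that z alone determines
  the vertical components of its derivative.\<close>

lemma hfield_derivative_inner:
  assumes "hfield z" "q \<noteq> 0"
  shows "frechet_derivative z (at q) v \<bullet> q = - (z q \<bullet> v)"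
    "frechet_derivative z (at q) v \<bullet> mult_i q = - (z q \<bullet> mult_i v)"
proof -
  note d = hfield_has_derivative[OF assms]
  have "(\<lambda>v. z q \<bullet> v + frechet_derivative z (at q) v \<bullet> q) = (\<lambda>v. 0)"
  proof (rule has_derivative_unique)
    show "((\<lambda>q. z q \<bullet> q) has_derivative (\<lambda>v. z q \<bullet> v + frechet_derivative z (at q) v \<bullet> q)) (at q)"
      by (intro has_derivative_inner d has_derivative_ident)
    show "((\<lambda>q. z q \<bullet> q) has_derivative (\<lambda>v. 0)) (at q)"
      by (rule has_derivative_transform_within_open[OF has_derivative_const[of 0] open_punctured])
         (use assms hfieldD(3)[OF assms(1)] in \<open>auto simp: horz_def\<close>)
  qed
  moreover have "(\<lambda>v. z q \<bullet> mult_i v + frechet_derivative z (at q) v \<bullet> mult_i q) = (\<lambda>v. 0)"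
  proof (rule has_derivative_unique)
    show "((\<lambda>q. z q \<bullet> mult_i q) has_derivative
        (\<lambda>v. z q \<bullet> mult_i v + frechet_derivative z (at q) v \<bullet> mult_i q)) (at q)"
      by (intro has_derivative_inner d mult_ijk_derivative has_derivative_ident)
    show "((\<lambda>q. z q \<bullet> mult_i q) has_derivative (\<lambda>v. 0)) (at q)"
      by (rule has_derivative_transform_within_open[OF has_derivative_const[of 0] open_punctured])
         (use assms hfieldD(3)[OF assms(1)] in \<open>auto simp: horz_def\<close>)
  qed
  ultimately show "frechet_derivative z (at q) v \<bullet> q = - (z q \<bullet> v)"
    "frechet_derivative z (at q) v \<bullet> mult_i q = - (z q \<bullet> mult_i v)"
    by (auto simp: fun_eq_iff add_eq_0_iff)
qed

text \<open>By equivariance z(q + t cq) = (1 + tc) z(q) for small t, an affine function of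
  t.\<close>

lemma hfield_derivative_radial:
  assumes "hfield z" "q \<noteq> 0"
  shows "frechet_derivative z (at q) (c *s q) = c *s z q"
proof -
  have 1: "((\<lambda>t::real. q + t *\<^sub>R (c *s q)) has_derivative (\<lambda>t. t *\<^sub>R (c *s q))) (at 0)"
    by (auto intro!: derivative_eq_intros)
  have 2: "(z has_derivative frechet_derivative z (at q)) (at (q + (0::real) *\<^sub>R (c *s q)))"
    using hfield_has_derivative[OF assms] by simp
  have 3: "((\<lambda>t::real. z (q + t *\<^sub>R (c *s q))) has_derivative
      (\<lambda>t. frechet_derivative z (at q) (t *\<^sub>R (c *s q)))) (at 0)"
    using has_derivative_compose[OF 1 2] .
  have 4: "z (q + t *\<^sub>R (c *s q)) = z q + t *\<^sub>R (c *s z q)" if "t \<in> ball 0 (inverse (norm c + 1))" for t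
    unfolding add_scale using hfieldD(4)[OF assms(1) one_plus_nonzero[OF that] assms(2)] .
  have "((\<lambda>t::real. z q + t *\<^sub>R (c *s z q)) has_derivative
      (\<lambda>t. frechet_derivative z (at q) (t *\<^sub>R (c *s q)))) (at 0)"
    by (rule has_derivative_transform_within_open[OF 3 open_ball[of 0 "inverse (norm c + 1)"] _ 4])
       (auto simp: add_nonneg_pos)
  moreover have "((\<lambda>t::real. z q + t *\<^sub>R (c *s z q)) has_derivative (\<lambda>t. t *\<^sub>R (c *s z q))) (at 0)"
    by (auto intro!: derivative_eq_intros)
  ultimately have "(\<lambda>t. frechet_derivative z (at q) (t *\<^sub>R (c *s q))) = (\<lambda>t::real. t *\<^sub>R (c *s z q))"
    by (rule has_derivative_unique)
  from fun_cong[OF this, of 1] show ?thesis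
    by simp
qed

lemma hfield_derivative_scale:
  assumes "hfield z" "q \<noteq> 0" "c \<noteq> 0"
  shows "frechet_derivative z (at (c *s q)) (c *s v) = c *s frechet_derivative z (at q) v"
proof -
  have "((\<lambda>q. z (c *s q)) has_derivative (\<lambda>v. frechet_derivative z (at (c *s q)) (c *s v))) (at q)"
    by (rule has_derivative_compose[OF bounded_linear_imp_has_derivative[OF bounded_linear_scale]
          hfield_has_derivative[OF assms(1)]])
       (use assms in \<open>simp add: scale_eq_0_iff\<close>)
  moreover have "((\<lambda>q. z (c *s q)) has_derivative (\<lambda>v. c *s frechet_derivative z (at q) v)) (at q)"
    by (rule has_derivative_transform_within_open[OF
          bounded_linear.has_derivative[OF bounded_linear_scale hfield_has_derivative[OF assms(1,2)]]
          open_punctured])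
       (use assms hfieldD(4)[OF assms(1)] in auto)
  ultimately show ?thesis
    using has_derivative_unique by metis
qed

lemma hor_scale:
  assumes "c \<noteq> 0"
  shows "hor (c *s q) (c *s v) = c *s hor q v"
proof -
  define n where "n = (Re c)\<^sup>2 + (Im c)\<^sup>2"
  have "n \<noteq> 0"
    using assms by (simp add: n_def complex_eq_iff sum_power2_eq_zero_iff)
  then show ?thesis
    unfolding hor_def mult_i_scale inner_scale n_def[symmetric]
    by (simp add: scale_eq quaternion_simps algebra_simps)
qed

text \<open>Not yet horizontal: for horizontal u, v its inner product with q is -2 times the pairing
  of their jq- and kq-components. Hence \<open>nabla_lift\<close> projects after adding it.\<close>

definition difference_tensor :: "complex^4 \<Rightarrow> complex^4 \<Rightarrow> complex^4 \<Rightarrow> complex^4"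
  where "difference_tensor q u v = (v \<bullet> mult_j q) *\<^sub>R mult_j u + (v \<bullet> mult_k q) *\<^sub>R mult_k u +
    (u \<bullet> mult_j q) *\<^sub>R mult_j v + (u \<bullet> mult_k q) *\<^sub>R mult_k v"

text \<open>A factor c leaves j as cbar, while x . jq + i (x . kq) is multiplied by c^2, and c^2
  cbar = |c|^2 c. The division by q . q in \<open>nabla_lift\<close> absorbs |c|^2 and restores
  equivariance.\<close>

lemma difference_tensor_scale: "difference_tensor (c *s q) (c *s u) (c *s v) = ((Re c)\<^sup>2 + (Im c)\<^sup>2) *\<^sub>R (c *s difference_tensor q u v)"
proof -
  have jk: "mult_j (c *s x) = Re c *\<^sub>R mult_j x - Im c *\<^sub>R mult_k x"
    "mult_k (c *s x) = Re c *\<^sub>R mult_k x + Im c *\<^sub>R mult_j x" for x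
    by (simp_all add: scale_eq quaternion_simps)
  have *: "(c *s x) \<bullet> mult_j (c *s q) =
      ((Re c)\<^sup>2 - (Im c)\<^sup>2) * (x \<bullet> mult_j q) - 2 * Re c * Im c * (x \<bullet> mult_k q)"
    "(c *s x) \<bullet> mult_k (c *s q) =
      ((Re c)\<^sup>2 - (Im c)\<^sup>2) * (x \<bullet> mult_k q) + 2 * Re c * Im c * (x \<bullet> mult_j q)" for x
    unfolding jk by (simp_all add: scale_eq quaternion_simps inner_simps power2_eq_square algebra_simps)
  show ?thesis
  proof (rule vector_eq_rdot[THEN iffD1], rule allI)
    fix w
    show "difference_tensor (c *s q) (c *s u) (c *s v) \<bullet> w = (((Re c)\<^sup>2 + (Im c)\<^sup>2) *\<^sub>R (c *s difference_tensor q u v)) \<bullet> w"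
      unfolding difference_tensor_def * unfolding jk
      by (simp add: scale_eq quaternion_simps inner_simps) algebra
  qed
qed

lemma difference_tensor_commute: "difference_tensor q u v = difference_tensor q v u"
  by (simp add: difference_tensor_def)

definition nabla_lift :: "real \<Rightarrow> (complex^4 \<Rightarrow> complex^4) \<Rightarrow> (complex^4 \<Rightarrow> complex^4) \<Rightarrow> complex^4 \<Rightarrow> complex^4"
  where "nabla_lift a y z q = hor q (frechet_derivative z (at q) (y q) + ((1 - a) / a / (q \<bullet> q)) *\<^sub>R difference_tensor q (y q) (z q))"

lemma smooth_on_nabla_lift_arg:
  assumes "hfield y" "hfield z"
  shows "smooth_on (- {0}) (\<lambda>q. frechet_derivative z (at q) (y q) + (\<kappa> / (q \<bullet> q)) *\<^sub>R difference_tensor q (y q) (z q))"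
  using hfieldD(1)[OF assms(1)] hfieldD(1)[OF assms(2)] unfolding difference_tensor_def
  by (intro smooth_intros smooth_on_frechet_derivative_along open_punctured) auto

lemma hfield_nabla_lift:
  assumes "hfield y" "hfield z"
  shows "hfield (nabla_lift a y z)"
  unfolding hfield_def equivariant_def
proof (intro conjI allI impI)
  show "smooth_on (- {0}) (nabla_lift a y z)"
    unfolding nabla_lift_def hor_def
    by (intro smooth_intros smooth_on_nabla_lift_arg assms) auto
next
  fix c :: complex and q :: "complex^4"
  assume c: "c \<noteq> 0" and q: "q \<noteq> 0"
  define n where "n = (Re c)\<^sup>2 + (Im c)\<^sup>2"
  have "n \<noteq> 0"
    using c by (simp add: n_def complex_eq_iff sum_power2_eq_zero_iff)
  have "frechet_derivative z (at (c *s q)) (y (c *s q)) +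
      ((1 - a) / a / ((c *s q) \<bullet> (c *s q))) *\<^sub>R difference_tensor (c *s q) (y (c *s q)) (z (c *s q)) =
    c *s (frechet_derivative z (at q) (y q) + ((1 - a) / a / (q \<bullet> q)) *\<^sub>R difference_tensor q (y q) (z q))"
    unfolding hfieldD(4)[OF assms(1) c q] hfieldD(4)[OF assms(2) c q] hfield_derivative_scale[OF assms(2) q c]
      difference_tensor_scale inner_scale n_def[symmetric]
    using \<open>n \<noteq> 0\<close> by (simp add: scale_eq quaternion_simps scaleR_add_right mult_ac)
  then show "nabla_lift a y z (c *s q) = c *s nabla_lift a y z q"
    unfolding nabla_lift_def by (simp only: hor_scale[OF c])
qed (auto simp: nabla_lift_def horz_hor)

text \<open>The value 0 off the vector fields matches the normalisation in
  \<open>levi_civita\<close>.\<close>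

definition conn :: "real \<Rightarrow> vfield \<Rightarrow> vfield \<Rightarrow> vfield"
  where "conn a X Y = (if X \<in> vector_fields \<and> Y \<in> vector_fields then down (nabla_lift a (lift X) (lift Y)) else 0)"

lemma conn_vector_fields: "X \<in> vector_fields \<Longrightarrow> Y \<in> vector_fields \<Longrightarrow> conn a X Y \<in> vector_fields"
  using hfield_nabla_lift[OF hfield_lift hfield_lift] by (auto simp: conn_def hfieldD intro!: down_vector_fields)

lemma lift_conn:
  "X \<in> vector_fields \<Longrightarrow> Y \<in> vector_fields \<Longrightarrow> q \<noteq> 0 \<Longrightarrow> lift (conn a X Y) q = nabla_lift a (lift X) (lift Y) q"
  by (simp add: conn_def lift_down hfield_nabla_lift hfield_lift)

text \<open>\<open>dproj\<close> kills vertical vectors, so the projection inside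
  \<open>nabla_lift\<close> disappears and the connection laws can be checked on the bare
  expression.\<close>

lemma conn_proj:
  assumes "X \<in> vector_fields" "Y \<in> vector_fields" "q \<noteq> 0"
  shows "conn a X Y (proj q) = dproj q (frechet_derivative (lift Y) (at q) (lift X q) +
    ((1 - a) / a / (q \<bullet> q)) *\<^sub>R difference_tensor q (lift X q) (lift Y q))"
  using assms hfield_nabla_lift[OF hfield_lift hfield_lift]
  by (simp add: conn_def down_proj hfieldD) (simp add: nabla_lift_def dproj_hor)

section \<open>Module structure of vector fields; connection laws and torsion\<close>

lemma vfield_eqI: "(\<And>q. q \<noteq> 0 \<Longrightarrow> X (proj q) = Y (proj q)) \<Longrightarrow> X = (Y :: vfield)"
  using proj_surj by (metis ext)

lemma smooth_fun_add: "smooth_fun f \<Longrightarrow> smooth_fun g \<Longrightarrow> smooth_fun (\<lambda>p. f p + g p)"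
  and smooth_fun_mult: "smooth_fun f \<Longrightarrow> smooth_fun g \<Longrightarrow> smooth_fun (\<lambda>p. f p * g p)"
  and smooth_fun_const: "smooth_fun (\<lambda>p. r)"
  unfolding smooth_fun_iff o_def by (auto intro: smooth_intros)

lemma vector_fields_add:
  assumes "X \<in> vector_fields" "Y \<in> vector_fields"
  shows "X + Y \<in> vector_fields"
  unfolding vector_fields_def
proof (intro CollectI conjI allI impI)
  fix p
  obtain q where q: "q \<noteq> 0" "proj q = p"
    using proj_surj by metis
  have "(X + Y) p = dproj q (lift X q + lift Y q)" "horz q (lift X q + lift Y q)"
    using lift_tangent[OF assms(1) q(1)] lift_tangent[OF assms(2) q(1)]
    by (simp_all add: linear_add[OF linear_dproj[OF q(1)]] q horz_add)
  then show "(X + Y) p \<in> tangent_space p"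
    using tangent_space_iff[OF q(1)] q(2) by auto
next
  fix f
  assume "smooth_fun f"
  then show "smooth_fun (deriv_along (X + Y) f)"
    using assms smooth_fun_add[of "deriv_along X f" "deriv_along Y f"]
    by (auto simp: vector_fields_def deriv_along_def)
qed

lemma vector_fields_scale:
  assumes "X \<in> vector_fields" "smooth_fun g"
  shows "(\<lambda>p. g p *\<^sub>R X p) \<in> vector_fields"
  unfolding vector_fields_def
proof (intro CollectI conjI allI impI)
  fix p
  obtain q where q: "q \<noteq> 0" "proj q = p"
    using proj_surj by metis
  have "g p *\<^sub>R X p = dproj q (g p *\<^sub>R lift X q)" "horz q (g p *\<^sub>R lift X q)"
    using lift_tangent[OF assms(1) q(1)]
    by (simp_all add: linear_cmul[OF linear_dproj[OF q(1)]] q horz_scaleR)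
  then show "g p *\<^sub>R X p \<in> tangent_space p"
    using tangent_space_iff[OF q(1)] q(2) by auto
next
  fix f
  assume "smooth_fun f"
  then show "smooth_fun (deriv_along (\<lambda>p. g p *\<^sub>R X p) f)"
    using assms smooth_fun_mult[of g "deriv_along X f"]
    by (auto simp: vector_fields_def deriv_along_def scaleR_fun_def)
qed

lemma vector_fields_diff:
  assumes "X \<in> vector_fields" "Y \<in> vector_fields"
  shows "X - Y \<in> vector_fields"
proof -
  have "X - Y = X + (\<lambda>p. (- 1) *\<^sub>R Y p)"
    by (auto simp: fun_eq_iff scaleR_fun_def)
  then show ?thesis
    using vector_fields_add[OF assms(1) vector_fields_scale[OF assms(2) smooth_fun_const[of "- 1"]]]
    by (simp only:)
qed

lemma lift_add: "lift (X + Y) q = lift X q + lift Y q"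
  by (simp add: lift_def distrib_right sum.distrib scaleR_add_left)

lemma lift_diff: "lift (X - Y) q = lift X q - lift Y q"
  by (simp add: lift_def left_diff_distrib sum_subtractf scaleR_diff_left)

lemma lift_scale: "lift (\<lambda>p. g p *\<^sub>R X p) q = g (proj q) *\<^sub>R lift X q"
  by (simp add: lift_def scaleR_fun_def scaleR_sum_right sum_distrib_left mult.assoc)

lemma vfield_apply:
  assumes "X \<in> vector_fields" "q \<noteq> 0" "smooth_fun f" "((f \<circ> proj) has_derivative D) (at q)"
  shows "X (proj q) f = D (lift X q)"
  using lift_tangent(2)[OF assms(1,2)] dproj_eqI[OF assms(3,4)] by metis

text \<open>The Leibniz term arises from the product (f o proj) times a lift;
  \<open>difference_tensor\<close> is bilinear over functions and adds no derivative of f.\<close>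

lemma is_connection_conn: "is_connection (conn a)"
  unfolding is_connection_def
proof (intro conjI ballI allI impI)
  fix X Y assume *: "X \<in> vector_fields" "Y \<in> vector_fields"
  then show "conn a X Y \<in> vector_fields"
    by (rule conn_vector_fields)
next
  fix X X' Y assume *: "X \<in> vector_fields" "X' \<in> vector_fields" "Y \<in> vector_fields"
  show "conn a (X + X') Y = conn a X Y + conn a X' Y"
  proof (rule vfield_eqI)
    fix q :: "complex^4" assume q: "q \<noteq> 0"
    note lin = linear_add[OF has_derivative_linear[OF hfield_has_derivative[OF hfield_lift q]]]
    show "conn a (X + X') Y (proj q) = (conn a X Y + conn a X' Y) (proj q)"
      using * q by (simp add: conn_proj vector_fields_add flip: linear_add[OF linear_dproj])
        (simp add: lift_add lin difference_tensor_def inner_simps quaternion_simps algebra_simps)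
  qed
next
  fix X Y Y' assume *: "X \<in> vector_fields" "Y \<in> vector_fields" "Y' \<in> vector_fields"
  show "conn a X (Y + Y') = conn a X Y + conn a X Y'"
  proof (rule vfield_eqI)
    fix q :: "complex^4" assume q: "q \<noteq> 0"
    have "frechet_derivative (lift (Y + Y')) (at q) v =
        frechet_derivative (lift Y) (at q) v + frechet_derivative (lift Y') (at q) v" for v
      using frechet_derivative_at[OF has_derivative_add[OF
            hfield_has_derivative[OF hfield_lift[OF *(2)] q] hfield_has_derivative[OF hfield_lift[OF *(3)] q]]]
      by (simp add: lift_add[abs_def] fun_eq_iff)
    then show "conn a X (Y + Y') (proj q) = (conn a X Y + conn a X Y') (proj q)"
      using * q by (simp add: conn_proj vector_fields_add flip: linear_add[OF linear_dproj])
        (simp add: lift_add difference_tensor_def inner_simps quaternion_simps algebra_simps)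
  qed
next
  fix f X Y assume *: "X \<in> vector_fields" "Y \<in> vector_fields" and f: "smooth_fun f"
  show "conn a (\<lambda>p. f p *\<^sub>R X p) Y = (\<lambda>p. f p *\<^sub>R conn a X Y p)"
  proof (rule vfield_eqI)
    fix q :: "complex^4" assume q: "q \<noteq> 0"
    note lin = linear_cmul[OF has_derivative_linear[OF hfield_has_derivative[OF hfield_lift q]]]
    show "conn a (\<lambda>p. f p *\<^sub>R X p) Y (proj q) = f (proj q) *\<^sub>R conn a X Y (proj q)"
      using * q f by (simp add: conn_proj vector_fields_scale flip: linear_cmul[OF linear_dproj])
        (simp add: lift_scale lin difference_tensor_def inner_simps quaternion_simps algebra_simps)
  qed
next
  fix f X Y assume *: "X \<in> vector_fields" "Y \<in> vector_fields" and f: "smooth_fun f"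
  show "conn a X (\<lambda>p. f p *\<^sub>R Y p) = (\<lambda>p. deriv_along X f p *\<^sub>R Y p + f p *\<^sub>R conn a X Y p)"
  proof (rule vfield_eqI)
    fix q :: "complex^4" assume q: "q \<noteq> 0"
    have "frechet_derivative (lift (\<lambda>p. f p *\<^sub>R Y p)) (at q) v =
        f (proj q) *\<^sub>R frechet_derivative (lift Y) (at q) v + dproj q v f *\<^sub>R lift Y q" for v
      using frechet_derivative_at[OF has_derivative_scaleR[OF
            has_derivative_dproj[OF f q] hfield_has_derivative[OF hfield_lift[OF *(2)] q]]]
      by (simp add: lift_scale[abs_def] fun_eq_iff)
    moreover have "Y (proj q) = dproj q (lift Y q)" "deriv_along X f (proj q) = dproj q (lift X q) f"
      using lift_tangent(2)[OF *(1) q] lift_tangent(2)[OF *(2) q] by (auto simp: deriv_along_def)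
    ultimately show "conn a X (\<lambda>p. f p *\<^sub>R Y p) (proj q) =
        deriv_along X f (proj q) *\<^sub>R Y (proj q) + f (proj q) *\<^sub>R conn a X Y (proj q)"
      using * q f by (simp add: conn_proj vector_fields_scale flip: linear_cmul[OF linear_dproj] linear_add[OF linear_dproj])
        (simp add: lift_scale difference_tensor_def inner_simps quaternion_simps algebra_simps)
  qed
qed

text \<open>The symmetric tensor part cancels. Applied to f, what remains is the commutator of the
  two derivatives, as the second derivatives of the pullback of f commute.\<close>

lemma torsion_free_conn: "torsion_free (conn a)"
  unfolding torsion_free_def
proof (intro ballI)
  fix X Y assume *: "X \<in> vector_fields" "Y \<in> vector_fields"
  show "conn a X Y - conn a Y X = bracket X Y"
  proof (rule vfield_eqI)
    fix q :: "complex^4" assume q: "q \<noteq> 0"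
    have 1: "(conn a X Y - conn a Y X) (proj q) =
        dproj q (frechet_derivative (lift Y) (at q) (lift X q) - frechet_derivative (lift X) (at q) (lift Y q))"
      using * q by (simp add: conn_proj difference_tensor_commute[of q "lift Y q"] flip: linear_diff[OF linear_dproj])
    show "(conn a X Y - conn a Y X) (proj q) = bracket X Y (proj q)"
      unfolding 1
    proof (rule ext)
      fix f
      show "dproj q (frechet_derivative (lift Y) (at q) (lift X q) - frechet_derivative (lift X) (at q) (lift Y q)) f =
        bracket X Y (proj q) f"
      proof (cases "smooth_fun f")
        case f: True
        define F where "F = f \<circ> proj"
        have sF: "smooth_on (- {0}) F"
          using f by (simp add: F_def smooth_fun_iff)
        have ap: "X (proj q) (deriv_along Y f) =
            frechet_derivative (\<lambda>x. frechet_derivative F (at x) (lift Y q)) (at q) (lift X q) +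
            frechet_derivative F (at q) (frechet_derivative (lift Y) (at q) (lift X q))"
          if XY: "X \<in> vector_fields" "Y \<in> vector_fields" for X Y
        proof (rule vfield_apply[OF XY(1) q])
          show "smooth_fun (deriv_along Y f)"
            using XY f by (simp add: vector_fields_def)
          have "((\<lambda>x. frechet_derivative F (at x) (lift Y x)) has_derivative
              (\<lambda>v. frechet_derivative (\<lambda>x. frechet_derivative F (at x) (lift Y q)) (at q) v +
            frechet_derivative F (at q) (frechet_derivative (lift Y) (at q) v))) (at q)"
            using has_derivative_frechet_derivative_along[OF open_punctured _ sF
                hfield_has_derivative[OF hfield_lift[OF XY(2)] q] refl] q by simp
          then show "(deriv_along Y f \<circ> proj has_derivative
              (\<lambda>v. frechet_derivative (\<lambda>x. frechet_derivative F (at x) (lift Y q)) (at q) v +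
            frechet_derivative F (at q) (frechet_derivative (lift Y) (at q) v))) (at q)"
          proof (rule has_derivative_transform_within_open[OF _ open_punctured])
            show "frechet_derivative F (at x) (lift Y x) = (deriv_along Y f \<circ> proj) x" if "x \<in> - {0}" for x
              using fun_cong[OF lift_tangent(2)[OF XY(2), of x], of f] that f
              by (simp add: deriv_along_def dproj_def F_def)
          qed (use q in simp)
        qed
        have "linear (frechet_derivative F (at q))"
          using smooth_on_has_derivative[OF open_punctured sF, of q] q has_derivative_linear by blast
        then show ?thesis
          using frechet_derivative_symmetric[OF open_punctured _ sF, of q "lift X q" "lift Y q"] q f
          by (simp add: bracket_def ap[OF *] ap[OF *(2,1)] dproj_def linear_diff flip: F_def)
      next
        \<comment> \<open>Equality of fields is tested on all functions. For non-smooth f,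
          \<open>deriv_along\<close> yields the zero function, which is smooth and annihilated by
          every field.\<close>
        case False
        have 1: "deriv_along X f = (\<lambda>p. 0)" if "X \<in> vector_fields" for X
        proof
          fix p
          obtain q where "q \<noteq> 0" "proj q = p"
            using proj_surj by metis
          then show "deriv_along X f p = 0"
            using lift_tangent(2)[OF that] dproj_nonsmooth[OF False] by (metis deriv_along_def)
        qed
        have 2: "X (proj q) (\<lambda>p. 0) = 0" if "X \<in> vector_fields" for X
          using vfield_apply[OF that q smooth_fun_const[of 0], where D = "\<lambda>v. 0"] by (simp add: o_def)
        show ?thesis
          using False by (simp add: bracket_def dproj_nonsmooth 1[OF *(1)] 1[OF *(2)] 2[OF *(1)] 2[OF *(2)])
      qed
    qed
  qed
qed

section \<open>The Levi-Civita connection\<close>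

lemma hor_inner: "horz q w \<Longrightarrow> hor q v \<bullet> w = v \<bullet> w"
  by (simp add: hor_def inner_simps horz_simps inner_mult_ijk_commute(1)[of w q] quaternion_simps)

lemma horz_mult_jk: "horz q (mult_j q)" "horz q (mult_k q)"
  using horz_jk[of q 1 0] horz_jk[of q 0 1] by simp_all

lemma ga_lift_eq:
  "X \<in> vector_fields \<Longrightarrow> Y \<in> vector_fields \<Longrightarrow> q \<noteq> 0 \<Longrightarrow>
    ga a (proj q) (X (proj q)) (Y (proj q)) = ga_lift a q (lift X q) (lift Y q)"
  using ga_dproj[of q "lift X q" "lift Y q" a] by (simp add: lift_tangent)

text \<open>Differentiating jq and kq along x leaves terms such as (1 - a)(y . jx)(z . jq). The
  difference tensor, being orthogonal to jq and kq, is seen by the a-weighted part only; by skewness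
  its contributions reduce to the same terms with factor a \<kappa> = 1 - a.\<close>

lemma metric_compatible_conn:
  assumes "a > 0"
  shows "metric_compatible (ga a) (conn a)"
  unfolding metric_compatible_def
proof (intro ballI allI)
  fix X Y Z p
  assume *: "X \<in> vector_fields" "Y \<in> vector_fields" "Z \<in> vector_fields"
  obtain q where q: "q \<in> sphere 0 1" "q \<noteq> 0" "proj q = p"
    using proj_surj by metis
  define x y z where xyz: "x = lift X" "y = lift Y" "z = lift Z"
  note h = hfield_lift[OF *(1), folded xyz] hfield_lift[OF *(2), folded xyz] hfield_lift[OF *(3), folded xyz]
  define A B where AB: "A = frechet_derivative y (at q)" "B = frechet_derivative z (at q)"
  have dy: "(y has_derivative A) (at q)" and dz: "(z has_derivative B) (at q)"
    using hfield_has_derivative h q by (auto simp: AB)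
  define G where "G = (\<lambda>p. ga a p (Y p) (Z p))"
  have G: "(G \<circ> proj) v = ga_lift a v (y v) (z v)" if "v \<noteq> 0" for v
    using ga_lift_eq[OF *(2,3) that] by (simp add: G_def xyz)
  have "smooth_on (- {0}) (\<lambda>v. ga_lift a v (y v) (z v))"
    unfolding ga_lift_def by (intro smooth_intros hfieldD h) auto
  then have sG: "smooth_fun G"
    unfolding smooth_fun_iff by (rule smooth_on_cong[OF open_punctured, rotated]) (use G in auto)
  define M where "M = (\<lambda>q. (y q \<bullet> mult_j q) * (z q \<bullet> mult_j q) + (y q \<bullet> mult_k q) * (z q \<bullet> mult_k q))"
  define M' where "M' = (\<lambda>v. (A v \<bullet> mult_j q + y q \<bullet> mult_j v) * (z q \<bullet> mult_j q) +
    (y q \<bullet> mult_j q) * (B v \<bullet> mult_j q + z q \<bullet> mult_j v) +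
    (A v \<bullet> mult_k q + y q \<bullet> mult_k v) * (z q \<bullet> mult_k q) +
    (y q \<bullet> mult_k q) * (B v \<bullet> mult_k q + z q \<bullet> mult_k v))"
  have dM: "(M has_derivative M') (at q)"
    unfolding M_def M'_def
    by (auto intro!: derivative_eq_intros dy dz simp: fun_eq_iff algebra_simps)
  have dA: "((\<lambda>q. a * (y q \<bullet> z q)) has_derivative (\<lambda>v. a * (y q \<bullet> B v + A v \<bullet> z q))) (at q)"
    by (intro has_derivative_mult_right has_derivative_inner dy dz)
  have dQ: "((\<lambda>q. q \<bullet> q) has_derivative (\<lambda>v. 2 * (q \<bullet> v))) (at q)"
    by (auto intro!: derivative_eq_intros simp: inner_commute)
  have q0: "q \<bullet> q \<noteq> 0"
    using q by simp
  have "((\<lambda>v. ga_lift a v (y v) (z v)) has_derivative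
      (\<lambda>v. ((a * (y q \<bullet> B v + A v \<bullet> z q) + ((1 - a) * M' v * (q \<bullet> q) - (1 - a) * M q * (2 * (q \<bullet> v))) /
        ((q \<bullet> q) * (q \<bullet> q))) * (q \<bullet> q) - (a * (y q \<bullet> z q) + (1 - a) * M q / (q \<bullet> q)) * (2 * (q \<bullet> v))) /
        ((q \<bullet> q) * (q \<bullet> q)))) (at q)"
    unfolding ga_lift_def
    using has_derivative_divide'[OF has_derivative_add[OF dA has_derivative_divide'[OF
            has_derivative_mult_right[OF dM, of "1 - a"] dQ q0]] dQ q0]
    by (simp only: M_def)
  then have dG: "(G \<circ> proj has_derivative
      (\<lambda>v. ((a * (y q \<bullet> B v + A v \<bullet> z q) + ((1 - a) * M' v * (q \<bullet> q) - (1 - a) * M q * (2 * (q \<bullet> v))) /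
        ((q \<bullet> q) * (q \<bullet> q))) * (q \<bullet> q) - (a * (y q \<bullet> z q) + (1 - a) * M q / (q \<bullet> q)) * (2 * (q \<bullet> v))) /
        ((q \<bullet> q) * (q \<bullet> q)))) (at q)"
    by (rule has_derivative_transform_within_open[OF _ open_punctured]) (use q G in auto)
  note hz = hfieldD(3)[OF h(1) q(2)] hfieldD(3)[OF h(2) q(2)] hfieldD(3)[OF h(3) q(2)]
  note simps = sphere_inner[OF q(1)] horz_simps[OF hz(1)] horz_simps[OF hz(2)] horz_simps[OF hz(3)]
  have lhs: "X (proj q) G = a * (y q \<bullet> B (x q) + A (x q) \<bullet> z q) + (1 - a) * M' (x q)"
    using vfield_apply[OF *(1) q(2) sG dG] by (simp add: simps flip: xyz)
  have "ga a (proj q) (conn a X Y (proj q)) (Z (proj q)) = ga_lift a q (nabla_lift a x y q) (z q)"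
    "ga a (proj q) (Y (proj q)) (conn a X Z (proj q)) = ga_lift a q (y q) (nabla_lift a x z q)"
    using ga_lift_eq[OF conn_vector_fields[OF *(1,2)] *(3) q(2)] ga_lift_eq[OF *(2) conn_vector_fields[OF *(1,3)] q(2)] * q(2)
    by (simp_all add: lift_conn xyz)
  moreover have "X (proj q) G = ga_lift a q (nabla_lift a x y q) (z q) + ga_lift a q (y q) (nabla_lift a x z q)"
  proof -
    define \<kappa> where "\<kappa> = (1 - a) / a"
    have k: "a * \<kappa> = 1 - a"
      using assms by (simp add: \<kappa>_def)
    have nabla_lift: "nabla_lift a x y q = hor q (A (x q) + \<kappa> *\<^sub>R difference_tensor q (x q) (y q))"
      "nabla_lift a x z q = hor q (B (x q) + \<kappa> *\<^sub>R difference_tensor q (x q) (z q))"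
      by (simp_all add: nabla_lift_def AB \<kappa>_def simps)
    have 1: "ga_lift a q (hor q v) w = a * (v \<bullet> w) +
        (1 - a) * ((v \<bullet> mult_j q) * (w \<bullet> mult_j q) + (v \<bullet> mult_k q) * (w \<bullet> mult_k q))" if "horz q w" for v w
      using that by (simp add: ga_lift_def hor_inner horz_mult_jk simps)
    have 2: "ga_lift a q w (hor q v) = a * (w \<bullet> v) +
        (1 - a) * ((v \<bullet> mult_j q) * (w \<bullet> mult_j q) + (v \<bullet> mult_k q) * (w \<bullet> mult_k q))" if "horz q w" for v w
      using 1[OF that, of v] by (simp add: ga_lift_def inner_commute mult.commute)
    have i: "x q \<bullet> mult_j (y q) = - (y q \<bullet> mult_j (x q))" "x q \<bullet> mult_k (y q) = - (y q \<bullet> mult_k (x q))"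
      "x q \<bullet> mult_j (z q) = - (z q \<bullet> mult_j (x q))" "x q \<bullet> mult_k (z q) = - (z q \<bullet> mult_k (x q))"
      "z q \<bullet> mult_j (y q) = - (y q \<bullet> mult_j (z q))" "z q \<bullet> mult_k (y q) = - (y q \<bullet> mult_k (z q))"
      "z q \<bullet> y q = y q \<bullet> z q"
      using inner_mult_ijk_commute inner_commute by blast+
    show ?thesis
      unfolding lhs nabla_lift 1[OF hz(3)] 2[OF hz(2)] M'_def difference_tensor_def
      by (simp add: inner_simps quaternion_simps simps i) (use k in algebra)
  qed
  ultimately show "deriv_along X (\<lambda>p. ga a p (Y p) (Z p)) p =
      ga a p (conn a X Y p) (Z p) + ga a p (Y p) (conn a X Z p)"
    by (simp add: deriv_along_def q(3)[symmetric] flip: G_def)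
qed

text \<open>With m the squared length of the projection of e to the span of jq and kq, the form
  equals a (|e|^2 - m) + m, a sum of nonnegative terms.\<close>

lemma ga_lift_definite:
  assumes "a > 0" "q \<in> sphere 0 1" "ga_lift a q e e = 0"
  shows "e = 0"
proof -
  define m where "m = (e \<bullet> mult_j q)\<^sup>2 + (e \<bullet> mult_k q)\<^sup>2"
  have "(e - D1_part q e) \<bullet> (e - D1_part q e) = e \<bullet> e - m"
    by (simp add: D1_part_def inner_simps quaternion_simps sphere_inner[OF assms(2)] m_def power2_eq_square inner_commute)
  then have "e \<bullet> e - m \<ge> 0"
    by (metis inner_ge_zero)
  moreover have "a * (e \<bullet> e - m) + m = 0"
    using assms(3) by (simp add: ga_lift_def sphere_inner[OF assms(2)] m_def power2_eq_square algebra_simps)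
  moreover have "m \<ge> 0"
    by (simp add: m_def)
  ultimately have "m = 0" "a * (e \<bullet> e - m) = 0"
    using assms(1) by (auto simp: add_nonneg_eq_0_iff)
  then show ?thesis
    using assms(1) by simp
qed

text \<open>The difference of two Levi-Civita connections, paired with a third field, is symmetric in the
  first two arguments and skew in the last two, hence zero.\<close>

lemma levi_civita_unique:
  assumes "a > 0"
    and D: "is_connection D" "torsion_free D" "metric_compatible (ga a) D"
    and D': "is_connection D'" "torsion_free D'" "metric_compatible (ga a) D'"
    and XY: "X \<in> vector_fields" "Y \<in> vector_fields"
  shows "D X Y = D' X Y"
proof
  fix p
  obtain q where q: "q \<in> sphere 0 1" "q \<noteq> 0" "proj q = p"
    using proj_surj by metis
  have vf: "D X Y \<in> vector_fields" "D' X Y \<in> vector_fields"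
    if "X \<in> vector_fields" "Y \<in> vector_fields" for X Y
    using D(1) D'(1) that by (auto simp: is_connection_def)
  define e where "e X Y = lift (D X Y) q - lift (D' X Y) q" for X Y
  define \<tau> where "\<tau> X Y Z = ga_lift a q (e X Y) (lift Z q)" for X Y Z
  have sym: "\<tau> X Y Z = \<tau> Y X Z" if "X \<in> vector_fields" "Y \<in> vector_fields" for X Y Z
  proof -
    have "D X Y - D Y X = D' X Y - D' Y X"
      using D(2) D'(2) that by (simp add: torsion_free_def)
    then have "lift (D X Y) q - lift (D Y X) q = lift (D' X Y) q - lift (D' Y X) q"
      by (metis lift_diff)
    then have "e X Y = e Y X"
      by (simp add: e_def algebra_simps)
    then show ?thesis
      by (simp add: \<tau>_def)
  qed
  have skew: "\<tau> X Y Z = - \<tau> X Z Y"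
    if "X \<in> vector_fields" "Y \<in> vector_fields" "Z \<in> vector_fields" for X Y Z
  proof -
    have "ga a (proj q) (D X Y (proj q)) (Z (proj q)) + ga a (proj q) (Y (proj q)) (D X Z (proj q)) =
        ga a (proj q) (D' X Y (proj q)) (Z (proj q)) + ga a (proj q) (Y (proj q)) (D' X Z (proj q))"
      using D(3) D'(3) that by (auto simp: metric_compatible_def)
    then have "ga_lift a q (lift (D X Y) q) (lift Z q) + ga_lift a q (lift Y q) (lift (D X Z) q) =
        ga_lift a q (lift (D' X Y) q) (lift Z q) + ga_lift a q (lift Y q) (lift (D' X Z) q)"
      by (simp only: ga_lift_eq vf that q(2) not_False_eq_True)
    then show ?thesis
      by (simp add: \<tau>_def e_def ga_lift_def sphere_inner[OF q(1)] inner_simps inner_commute algebra_simps)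
  qed
  \<comment> \<open>The third argument is the difference itself, already a global field, so no
    tangent vector has to be extended. Alternating \<open>sym\<close> and \<open>skew\<close> six
    times gives \<tau> = - \<tau>.\<close>
  have "\<tau> X Y (D X Y - D' X Y) = 0"
    using sym skew vector_fields_diff[OF vf[OF XY]] XY by smt
  then have "ga_lift a q (e X Y) (e X Y) = 0"
    by (simp add: \<tau>_def lift_diff flip: e_def)
  then have "e X Y = 0"
    using ga_lift_definite[OF assms(1) q(1)] by blast
  then show "D X Y p = D' X Y p"
    using lift_tangent(2)[OF vf(1)[OF XY] q(2)] lift_tangent(2)[OF vf(2)[OF XY] q(2)] q(3)
    by (simp add: e_def)
qed

lemma levi_civita_ga:
  assumes "a > 0"
  shows "levi_civita (ga a) = conn a"
  unfolding levi_civita_def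
proof (rule the_equality)
  show "is_connection (conn a) \<and> torsion_free (conn a) \<and> metric_compatible (ga a) (conn a) \<and>
    (\<forall>X Y. X \<notin> vector_fields \<or> Y \<notin> vector_fields \<longrightarrow> conn a X Y = 0)"
    using is_connection_conn torsion_free_conn metric_compatible_conn[OF assms] by (auto simp: conn_def)
next
  fix D
  assume D: "is_connection D \<and> torsion_free D \<and> metric_compatible (ga a) D \<and>
    (\<forall>X Y. X \<notin> vector_fields \<or> Y \<notin> vector_fields \<longrightarrow> D X Y = 0)"
  show "D = conn a"
  proof (intro ext)
    fix X Y p f
    show "D X Y p f = conn a X Y p f"
    proof (cases "X \<in> vector_fields \<and> Y \<in> vector_fields")
      case True
      then show ?thesis
        using levi_civita_unique[OF assms _ _ _ is_connection_conn torsion_free_conn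
            metric_compatible_conn[OF assms], of D X Y] D by simp
    next
      case False
      then show ?thesis
        using D by (auto simp: conn_def)
    qed
  qed
qed

section \<open>An identity special to quaternionic dimension two\<close>

definition quat_orth :: "complex^4 \<Rightarrow> complex^4 \<Rightarrow> bool"
  where "quat_orth q v \<longleftrightarrow> v \<bullet> q = 0 \<and> v \<bullet> mult_i q = 0 \<and> v \<bullet> mult_j q = 0 \<and> v \<bullet> mult_k q = 0"

lemma quat_orth_simps:
  assumes "quat_orth q v"
  shows "v \<bullet> q = 0" "v \<bullet> mult_i q = 0" "v \<bullet> mult_j q = 0" "v \<bullet> mult_k q = 0"
    "q \<bullet> v = 0" "q \<bullet> mult_i v = 0" "q \<bullet> mult_j v = 0" "q \<bullet> mult_k v = 0"
  using assms by (auto simp: quat_orth_def inner_mult_ijk_commute[of q v] inner_commute[of q v])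

text \<open>For nonzero y the vectors q, iq, jq, kq, y, iy, jy, ky are orthogonal and, being eight,
  span R^8. The difference of the two sides is orthogonal to all of them. The factor y . y on the
  left avoids a division and admits y = 0.\<close>

lemma quaternionic_line:
  assumes q: "q \<noteq> 0" and y: "quat_orth q y" and w: "quat_orth q w"
  shows "(y \<bullet> y) *\<^sub>R w = (w \<bullet> y) *\<^sub>R y + (w \<bullet> mult_i y) *\<^sub>R mult_i y +
    (w \<bullet> mult_j y) *\<^sub>R mult_j y + (w \<bullet> mult_k y) *\<^sub>R mult_k y"
proof (cases "y = 0")
  case True
  then show ?thesis by (simp add: quaternion_simps)
next
  case False
  define B where "B = [q, mult_i q, mult_j q, mult_k q, y, mult_i y, mult_j y, mult_k y]"
  note simps = quaternion_simps inner_simps quat_orth_simps[OF y]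
  have pos: "q \<bullet> q > 0" "y \<bullet> y > 0"
    using q False by auto
  \<comment> \<open>Turns equations between members of \<open>B\<close> into numerical ones decided
    by orthogonality. Distinctness matters because the dimension count uses the cardinality of a
    set.\<close>
  have eq: "u = v \<longleftrightarrow> u \<bullet> u - 2 * (u \<bullet> v) + v \<bullet> v = 0" for u v :: "complex^4"
  proof -
    have "u = v \<longleftrightarrow> (u - v) \<bullet> (u - v) = 0"
      by simp
    then show ?thesis
      by (simp add: inner_simps inner_commute algebra_simps)
  qed
  have nz: "2 * (q \<bullet> q) \<noteq> 0" "q \<bullet> q + y \<bullet> y \<noteq> 0" "2 * (y \<bullet> y) \<noteq> 0"
    using pos by linarith+
  have "distinct B"
    unfolding B_def distinct.simps set_simps insert_iff empty_iff eq
    using nz by (simp add: simps)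
  then have card: "card (set B) = 8"
    by (simp add: distinct_card B_def)
  have "pairwise orthogonal (set B)"
    unfolding B_def by (auto simp: pairwise_insert orthogonal_def simps)
  moreover have "0 \<notin> set B"
    using pos by (simp add: B_def eq[of 0] simps)
  ultimately have "independent (set B)"
    by (rule pairwise_orthogonal_independent)
  then have span: "span (set B) = UNIV"
    using card card_ge_dim_independent[of "set B" UNIV] by auto
  define r where "r = (y \<bullet> y) *\<^sub>R w - ((w \<bullet> y) *\<^sub>R y + (w \<bullet> mult_i y) *\<^sub>R mult_i y +
    (w \<bullet> mult_j y) *\<^sub>R mult_j y + (w \<bullet> mult_k y) *\<^sub>R mult_k y)"
  have "orthogonal r b" if "b \<in> set B" for b
    using that unfolding B_def r_def
    by (auto simp: orthogonal_def simps quat_orth_simps[OF w])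
  then have "orthogonal r r"
    using orthogonal_to_span[of r "set B" r] span by simp
  then show ?thesis
    by (simp add: orthogonal_def r_def)
qed

text \<open>Polarisation: the cases y = b and y = c of \<open>quaternionic_line\<close> are
  subtracted from y = b + c after pairing with a; skewness moves i, j, k onto d.\<close>

lemma quaternionic_line_polarized:
  assumes q: "q \<noteq> 0" and b: "quat_orth q b" and c: "quat_orth q c" and d: "quat_orth q d"
  shows "(a \<bullet> mult_i b) * (c \<bullet> mult_i d) + (a \<bullet> mult_j b) * (c \<bullet> mult_j d) + (a \<bullet> mult_k b) * (c \<bullet> mult_k d) +
    (a \<bullet> mult_i c) * (b \<bullet> mult_i d) + (a \<bullet> mult_j c) * (b \<bullet> mult_j d) + (a \<bullet> mult_k c) * (b \<bullet> mult_k d) =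
    (a \<bullet> c) * (b \<bullet> d) + (a \<bullet> b) * (c \<bullet> d) - 2 * (a \<bullet> d) * (b \<bullet> c)"
proof -
  have bc: "quat_orth q (b + c)"
    using b c by (simp add: quat_orth_def inner_simps)
  have *: "(y \<bullet> y) * (a \<bullet> d) = (d \<bullet> y) * (a \<bullet> y) + (d \<bullet> mult_i y) * (a \<bullet> mult_i y) +
    (d \<bullet> mult_j y) * (a \<bullet> mult_j y) + (d \<bullet> mult_k y) * (a \<bullet> mult_k y)" if "quat_orth q y" for y
    using arg_cong[OF quaternionic_line[OF q that d], of "\<lambda>v. a \<bullet> v"] by (simp add: inner_simps)
  have sw: "d \<bullet> mult_i b = - (b \<bullet> mult_i d)" "d \<bullet> mult_j b = - (b \<bullet> mult_j d)" "d \<bullet> mult_k b = - (b \<bullet> mult_k d)"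
    "d \<bullet> mult_i c = - (c \<bullet> mult_i d)" "d \<bullet> mult_j c = - (c \<bullet> mult_j d)" "d \<bullet> mult_k c = - (c \<bullet> mult_k d)"
    "d \<bullet> b = b \<bullet> d" "d \<bullet> c = c \<bullet> d" "c \<bullet> b = b \<bullet> c"
    using inner_mult_ijk_commute inner_commute by blast+
  show ?thesis
    using *[OF bc] *[OF b] *[OF c]
    by (simp add: inner_simps quaternion_simps sw) (simp add: algebra_simps)
qed

section \<open>Curvature\<close>

text \<open>The derivatives of the two coefficients in \<open>hor\<close> multiply q and iq, which w
  annihilates, and 1 / (q . q) is stationary along x because x . q = 0. So only the values of the
  coefficients, in the last line, survive.\<close>

lemma nabla_lift_derivative:
  assumes h: "hfield y" "hfield z" and q: "q \<in> sphere 0 1" and xw: "horz q x" "horz q w" and k: "\<kappa> = (1 - a) / a"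
    and A: "A = frechet_derivative z (at q) (y q)"
    and B: "B = frechet_derivative z (at q) x"
    and C: "C = frechet_derivative y (at q) x"
  shows "frechet_derivative (nabla_lift a y z) (at q) x \<bullet> w =
    frechet_derivative (\<lambda>p. frechet_derivative z (at p) (y q)) (at q) x \<bullet> w +
    frechet_derivative z (at q) C \<bullet> w +
    \<kappa> * (((B \<bullet> mult_j q + z q \<bullet> mult_j x) *\<^sub>R mult_j (y q) + (z q \<bullet> mult_j q) *\<^sub>R mult_j C +
      (B \<bullet> mult_k q + z q \<bullet> mult_k x) *\<^sub>R mult_k (y q) + (z q \<bullet> mult_k q) *\<^sub>R mult_k C +
      (C \<bullet> mult_j q + y q \<bullet> mult_j x) *\<^sub>R mult_j (z q) + (y q \<bullet> mult_j q) *\<^sub>R mult_j B +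
      (C \<bullet> mult_k q + y q \<bullet> mult_k x) *\<^sub>R mult_k (z q) + (y q \<bullet> mult_k q) *\<^sub>R mult_k B) \<bullet> w) -
    ((A + \<kappa> *\<^sub>R difference_tensor q (y q) (z q)) \<bullet> q) * (x \<bullet> w) - ((A + \<kappa> *\<^sub>R difference_tensor q (y q) (z q)) \<bullet> mult_i q) * (mult_i x \<bullet> w)"
proof -
  have q0: "q \<noteq> 0" "q \<in> - {0}"
    using q by auto
  define C' where "C' = frechet_derivative y (at q)"
  define B' where "B' = frechet_derivative z (at q)"
  have dy: "(y has_derivative C') (at q)" and dz: "(z has_derivative B') (at q)"
    using hfield_has_derivative[OF h(1) q0(1)] hfield_has_derivative[OF h(2) q0(1)] by (simp_all add: C'_def B'_def)
  define S where "S = (\<lambda>q. difference_tensor q (y q) (z q))"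
  define S' where "S' = (\<lambda>x. (B' x \<bullet> mult_j q + z q \<bullet> mult_j x) *\<^sub>R mult_j (y q) + (z q \<bullet> mult_j q) *\<^sub>R mult_j (C' x) +
      (B' x \<bullet> mult_k q + z q \<bullet> mult_k x) *\<^sub>R mult_k (y q) + (z q \<bullet> mult_k q) *\<^sub>R mult_k (C' x) +
      (C' x \<bullet> mult_j q + y q \<bullet> mult_j x) *\<^sub>R mult_j (z q) + (y q \<bullet> mult_j q) *\<^sub>R mult_j (B' x) +
      (C' x \<bullet> mult_k q + y q \<bullet> mult_k x) *\<^sub>R mult_k (z q) + (y q \<bullet> mult_k q) *\<^sub>R mult_k (B' x))"
  have dS: "(S has_derivative S') (at q)"
    unfolding S_def S'_def difference_tensor_def
    by (rule has_derivative_eq_rhs, (rule derivative_intros dy dz)+) (simp add: fun_eq_iff algebra_simps)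
  define D where "D = frechet_derivative (\<lambda>p. frechet_derivative z (at p) (y q)) (at q)"
  have dW0: "((\<lambda>p. frechet_derivative z (at p) (y p)) has_derivative (\<lambda>v. D v + B' (C' v))) (at q)"
    using has_derivative_frechet_derivative_along[OF open_punctured q0(2) hfieldD(1)[OF h(2)] dy refl]
    by (simp add: D_def B'_def)
  have dQ: "((\<lambda>q. q \<bullet> q) has_derivative (\<lambda>v. 2 * (q \<bullet> v))) (at q)"
    by (auto intro!: derivative_eq_intros simp: inner_commute)
  have qq: "q \<bullet> q = 1" "q \<bullet> x = 0" "q \<bullet> mult_i x = 0" "x \<bullet> q = 0" "x \<bullet> mult_i q = 0"
    "q \<bullet> w = 0" "q \<bullet> mult_i w = 0" "w \<bullet> q = 0" "w \<bullet> mult_i q = 0"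
    using sphere_inner[OF q] horz_simps[OF xw(1)] horz_simps[OF xw(2)] by auto
  define W where "W = (\<lambda>q. frechet_derivative z (at q) (y q) + (\<kappa> / (q \<bullet> q)) *\<^sub>R S q)"
  define W' where "W' = (\<lambda>v. D v + B' (C' v) + ((\<kappa> / (q \<bullet> q)) *\<^sub>R S' v + (- \<kappa> * (2 * (q \<bullet> v)) / ((q \<bullet> q) * (q \<bullet> q))) *\<^sub>R S q))"
  have dW: "(W has_derivative W') (at q)"
    unfolding W_def W'_def
    using has_derivative_add[OF dW0 has_derivative_scaleR[OF has_derivative_divide'[OF
            has_derivative_const[of \<kappa>] dQ] dS]] qq(1) by simp
  have nabla_lift: "nabla_lift a y z = (\<lambda>q. hor q (W q))"
    by (simp add: fun_eq_iff nabla_lift_def W_def S_def k)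
  define \<mu> where "\<mu> = (\<lambda>q. (W q \<bullet> q) / (q \<bullet> q))"
  define \<nu> where "\<nu> = (\<lambda>q. (W q \<bullet> mult_i q) / (q \<bullet> q))"
  obtain \<mu>' where d\<mu>: "(\<mu> has_derivative \<mu>') (at q)"
    unfolding \<mu>_def
    using has_derivative_divide'[OF has_derivative_inner[OF dW has_derivative_ident] dQ] qq(1) by auto
  obtain \<nu>' where d\<nu>: "(\<nu> has_derivative \<nu>') (at q)"
    unfolding \<nu>_def
    using has_derivative_divide'[OF has_derivative_inner[OF dW mult_ijk_derivative(1)[OF has_derivative_ident]] dQ]
      qq(1) by auto
  have "(nabla_lift a y z has_derivative (\<lambda>v. W' v - (\<mu> q *\<^sub>R v + \<mu>' v *\<^sub>R q) - (\<nu> q *\<^sub>R mult_i v + \<nu>' v *\<^sub>R mult_i q))) (at q)"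
    unfolding nabla_lift hor_def \<mu>_def[symmetric, THEN fun_cong] \<nu>_def[symmetric, THEN fun_cong]
    by (intro has_derivative_diff has_derivative_scaleR dW d\<mu> d\<nu> mult_ijk_derivative has_derivative_ident)
  from fun_cong[OF frechet_derivative_at[OF this], of x, symmetric]
  have "frechet_derivative (nabla_lift a y z) (at q) x =
      W' x - (\<mu> q *\<^sub>R x + \<mu>' x *\<^sub>R q) - (\<nu> q *\<^sub>R mult_i x + \<nu>' x *\<^sub>R mult_i q)"
    .
  then have "frechet_derivative (nabla_lift a y z) (at q) x \<bullet> w =
      D x \<bullet> w + B' (C' x) \<bullet> w + \<kappa> * (S' x \<bullet> w) - \<mu> q * (x \<bullet> w) - \<nu> q * (mult_i x \<bullet> w)"
    by (simp add: W'_def inner_simps qq mult_ijk_inner)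
  moreover have "\<mu> q = (A + \<kappa> *\<^sub>R difference_tensor q (y q) (z q)) \<bullet> q" "\<nu> q = (A + \<kappa> *\<^sub>R difference_tensor q (y q) (z q)) \<bullet> mult_i q"
    by (simp_all add: \<mu>_def \<nu>_def W_def S_def A qq)
  moreover have "C = C' x" "B = B' x" "B' = frechet_derivative z (at q)"
    by (simp_all add: C B C'_def B'_def)
  ultimately show ?thesis
    unfolding S'_def D_def by simp
qed

text \<open>\<open>dproj\<close> forgets vertical parts, so horizontal test vectors decide; the
  difference of the horizontal parts is itself such a test vector.\<close>

lemma dproj_eqI_horz:
  assumes "q \<noteq> 0" "\<And>w. horz q w \<Longrightarrow> u \<bullet> w = v \<bullet> w"
  shows "dproj q u = dproj q v"
proof -
  have "horz q (hor q u - hor q v)"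
    by (simp add: horz_diff horz_hor assms(1))
  then have "(hor q u - hor q v) \<bullet> (hor q u - hor q v) = 0"
    using assms(2)[of "hor q u - hor q v"] by (simp add: inner_diff_left[of "hor q u"] hor_inner)
  then have "hor q u = hor q v"
    by simp
  then show ?thesis
    using dproj_hor[OF assms(1)] by metis
qed

text \<open>The covariant derivative of \<open>nabla_lift a y z\<close> along \<open>x\<close> at a unit vector, up to a vertical vector and
  computed as if all derivatives of the three fields were vertical (so that they are determined by horizontality).\<close>

definition curv_half :: "real \<Rightarrow> complex^4 \<Rightarrow> complex^4 \<Rightarrow> complex^4 \<Rightarrow> complex^4 \<Rightarrow> complex^4"
  where "curv_half \<kappa> q x y z = 
    (- (y \<bullet> x)) *\<^sub>R z - (y \<bullet> mult_i x) *\<^sub>R mult_i z +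
    (z \<bullet> y + 2 * \<kappa> * ((y \<bullet> mult_j q) * (z \<bullet> mult_j q) + (y \<bullet> mult_k q) * (z \<bullet> mult_k q))) *\<^sub>R x +
    (z \<bullet> mult_i y) *\<^sub>R mult_i x +
    \<kappa> *\<^sub>R ((z \<bullet> mult_j x) *\<^sub>R mult_j y + (z \<bullet> mult_k x) *\<^sub>R mult_k y +
      (y \<bullet> mult_j x) *\<^sub>R mult_j z + (y \<bullet> mult_k x) *\<^sub>R mult_k z) +
    \<kappa> *\<^sub>R ((y \<bullet> mult_i x) *\<^sub>R ((z \<bullet> mult_j q) *\<^sub>R mult_k q - (z \<bullet> mult_k q) *\<^sub>R mult_j q) -
      (y \<bullet> x) *\<^sub>R ((z \<bullet> mult_j q) *\<^sub>R mult_j q + (z \<bullet> mult_k q) *\<^sub>R mult_k q) +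
      (z \<bullet> mult_i x) *\<^sub>R ((y \<bullet> mult_j q) *\<^sub>R mult_k q - (y \<bullet> mult_k q) *\<^sub>R mult_j q) -
      (z \<bullet> x) *\<^sub>R ((y \<bullet> mult_j q) *\<^sub>R mult_j q + (y \<bullet> mult_k q) *\<^sub>R mult_k q)) +
    (\<kappa> * \<kappa>) *\<^sub>R difference_tensor q x (difference_tensor q y z + (2 * ((y \<bullet> mult_j q) * (z \<bullet> mult_j q) + (y \<bullet> mult_k q) * (z \<bullet> mult_k q))) *\<^sub>R q)"

text \<open>Second derivatives of z cancel by symmetry, and Dz of Dy(x) and Dx(y) cancels against Dz
  of the lifted bracket. Of the first derivatives only the vertical components remain, and these are
  known. The multiple of q added inside the last summand of \<open>curv_half\<close> makes
  \<open>difference_tensor q y z\<close> horizontal.\<close>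

lemma riemann_lift:
  assumes a: "a > 0" and XYZ: "X \<in> vector_fields" "Y \<in> vector_fields" "Z \<in> vector_fields"
    and q: "q \<in> sphere 0 1" and k: "\<kappa> = (1 - a) / a"
  shows "riemann (ga a) X Y Z (proj q) =
    dproj q (curv_half \<kappa> q (lift X q) (lift Y q) (lift Z q) - curv_half \<kappa> q (lift Y q) (lift X q) (lift Z q))"
proof -
  have q0: "q \<noteq> 0" "q \<in> - {0}"
    using q by auto
  define x y z where xyz: "x = lift X" "y = lift Y" "z = lift Z"
  note h = hfield_lift[OF XYZ(1), folded xyz] hfield_lift[OF XYZ(2), folded xyz] hfield_lift[OF XYZ(3), folded xyz]
  \<comment> \<open>Torsion-freeness shows that the bracket is a vector field and gives its
    lift.\<close>
  have br: "bracket X Y = conn a X Y - conn a Y X"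
    using torsion_free_conn[of a] XYZ by (simp add: torsion_free_def)
  have vf: "conn a Y Z \<in> vector_fields" "conn a X Z \<in> vector_fields" "bracket X Y \<in> vector_fields"
    unfolding br by (intro vector_fields_diff conn_vector_fields XYZ)+
  have fr: "frechet_derivative (lift (conn a U V)) (at q) = frechet_derivative (nabla_lift a (lift U) (lift V)) (at q)"
    if "U \<in> vector_fields" "V \<in> vector_fields" for U V
    by (rule frechet_derivative_transform_within_open[OF _ open_punctured q0(2)])
       (use lift_conn[OF that] hfield_has_derivative[OF hfield_lift[OF conn_vector_fields[OF that]] q0(1)]
         in \<open>auto simp: differentiable_def\<close>)
  define u where "u = lift (bracket X Y) q"
  have u: "u = nabla_lift a x y q - nabla_lift a y x q"
    unfolding u_def br lift_diff using XYZ q0 by (simp add: lift_conn xyz)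
  define V where "V = (frechet_derivative (nabla_lift a y z) (at q) (x q) + \<kappa> *\<^sub>R difference_tensor q (x q) (nabla_lift a y z q)) -
    (frechet_derivative (nabla_lift a x z) (at q) (y q) + \<kappa> *\<^sub>R difference_tensor q (y q) (nabla_lift a x z q)) -
    (frechet_derivative z (at q) u + \<kappa> *\<^sub>R difference_tensor q u (z q))"
  have "riemann (ga a) X Y Z (proj q) = dproj q V"
    unfolding riemann_def levi_civita_ga[OF a]
    by (simp add: conn_proj[OF _ _ q0(1)] XYZ vf fr lift_conn[OF _ _ q0(1)] sphere_inner[OF q] V_def
        linear_diff[OF linear_dproj[OF q0(1)]] flip: k xyz u_def)
  also have "dproj q V = dproj q (curv_half \<kappa> q (x q) (y q) (z q) - curv_half \<kappa> q (y q) (x q) (z q))"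
  proof (rule dproj_eqI_horz[OF q0(1)])
    fix w
    assume w: "horz q w"
    note hz = hfieldD(3)[OF h(1) q0(1)] hfieldD(3)[OF h(2) q0(1)] hfieldD(3)[OF h(3) q0(1)]
    define A B C E where ABCE: "A = frechet_derivative z (at q) (y q)" "B = frechet_derivative z (at q) (x q)"
      "C = frechet_derivative y (at q) (x q)" "E = frechet_derivative x (at q) (y q)"
    note in1 = hfield_derivative_inner[OF h(3) q0(1), of "y q", folded ABCE]
    note in2 = hfield_derivative_inner[OF h(3) q0(1), of "x q", folded ABCE]
    note in3 = hfield_derivative_inner[OF h(2) q0(1), of "x q", folded ABCE]
    note in4 = hfield_derivative_inner[OF h(1) q0(1), of "y q", folded ABCE]
    define x' y' z' where v': "x' = x q" "y' = y q" "z' = z q"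
    note v = v'[symmetric]
    note basic = horz_simps[OF hz(1), unfolded v] horz_simps[OF hz(2), unfolded v] horz_simps[OF hz(3), unfolded v]
      horz_simps[OF w] sphere_inner[OF q] in1[unfolded v] in2[unfolded v] in3[unfolded v] in4[unfolded v]
    have sw: "y' \<bullet> mult_i x' = - (x' \<bullet> mult_i y')" "y' \<bullet> mult_j x' = - (x' \<bullet> mult_j y')" "y' \<bullet> mult_k x' = - (x' \<bullet> mult_k y')"
      "z' \<bullet> mult_i x' = - (x' \<bullet> mult_i z')" "z' \<bullet> mult_j x' = - (x' \<bullet> mult_j z')" "z' \<bullet> mult_k x' = - (x' \<bullet> mult_k z')"
      "z' \<bullet> mult_i y' = - (y' \<bullet> mult_i z')" "z' \<bullet> mult_j y' = - (y' \<bullet> mult_j z')" "z' \<bullet> mult_k y' = - (y' \<bullet> mult_k z')"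
      "q \<bullet> mult_j x' = - (x' \<bullet> mult_j q)" "q \<bullet> mult_k x' = - (x' \<bullet> mult_k q)"
      "q \<bullet> mult_j y' = - (y' \<bullet> mult_j q)" "q \<bullet> mult_k y' = - (y' \<bullet> mult_k q)"
      "q \<bullet> mult_j z' = - (z' \<bullet> mult_j q)" "q \<bullet> mult_k z' = - (z' \<bullet> mult_k q)"
      "q \<bullet> mult_j w = - (w \<bullet> mult_j q)" "q \<bullet> mult_k w = - (w \<bullet> mult_k q)"
      "y' \<bullet> x' = x' \<bullet> y'" "z' \<bullet> x' = x' \<bullet> z'" "z' \<bullet> y' = y' \<bullet> z'"
      using inner_mult_ijk_commute inner_commute by blast+
    have nablas: "nabla_lift a y z q = hor q (A + \<kappa> *\<^sub>R difference_tensor q y' z')" "nabla_lift a x z q = hor q (B + \<kappa> *\<^sub>R difference_tensor q x' z')"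
      "nabla_lift a x y q = hor q (C + \<kappa> *\<^sub>R difference_tensor q x' y')" "nabla_lift a y x q = hor q (E + \<kappa> *\<^sub>R difference_tensor q y' x')"
      by (simp_all add: nabla_lift_def ABCE k sphere_inner[OF q] v)
    \<comment> \<open>Dy(x) and Dx(y) have equal components along q and opposite ones along iq, so
      projecting their difference adds a multiple of iq.\<close>
    have u': "u = C - E + (2 * (y' \<bullet> mult_i x')) *\<^sub>R mult_i q"
    proof (rule vector_eq_rdot[THEN iffD1], rule allI)
      fix v
      show "u \<bullet> v = (C - E + (2 * (y' \<bullet> mult_i x')) *\<^sub>R mult_i q) \<bullet> v"
        unfolding u nablas
        by (simp add: hor_def difference_tensor_commute[of q y' x'] inner_simps basic sw) (simp add: algebra_simps)
    qed
    \<comment> \<open>Equivariance with c = i evaluates the derivative along the vertical part of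
      the bracket.\<close>
    have "frechet_derivative z (at q) (mult_i q) = mult_i z'"
      using hfield_derivative_radial[OF h(3) q0(1), of \<i>] by (simp add: mult_i_def v)
    then have zu: "frechet_derivative z (at q) u =
        frechet_derivative z (at q) C - frechet_derivative z (at q) E + (2 * (y' \<bullet> mult_i x')) *\<^sub>R mult_i z'"
      using has_derivative_linear[OF hfield_has_derivative[OF h(3) q0(1)]]
      by (simp add: u' linear_add linear_diff linear_cmul)
    have sym: "frechet_derivative (\<lambda>p. frechet_derivative z (at p) y') (at q) x' =
        frechet_derivative (\<lambda>p. frechet_derivative z (at p) x') (at q) y'"
      by (rule frechet_derivative_symmetric[OF open_punctured q0(2) hfieldD(1)[OF h(3)]])
    note d1 = nabla_lift_derivative[OF h(2,3) q hz(1) w k ABCE(1,2,3), unfolded v]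
    note d2 = nabla_lift_derivative[OF h(1,3) q hz(2) w k ABCE(2,1,4), unfolded v]
    show "V \<bullet> w = (curv_half \<kappa> q (x q) (y q) (z q) - curv_half \<kappa> q (y q) (x q) (z q)) \<bullet> w"
      unfolding V_def inner_diff_left inner_add_left v d1 d2 zu sym nablas
      unfolding u'
      by (simp add: difference_tensor_def curv_half_def hor_def inner_simps quaternion_simps basic sw) algebra
  qed
  finally show ?thesis
    unfolding xyz .
qed

lemma wedge_dproj:
  assumes "q \<noteq> 0" "horz q u" "horz q v" "horz q t"
  shows "wedge a (proj q) (dproj q u) (dproj q v) (dproj q t) = dproj q (ga_lift a q v t *\<^sub>R u - ga_lift a q u t *\<^sub>R v)"
  using assms by (simp add: wedge_def ga_dproj linear_diff[OF linear_dproj] linear_cmul[OF linear_dproj])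

text \<open>Because a (\<kappa> + 1) = 1, all coefficients are polynomials in \<kappa>. As
  polynomials in inner products the two sides agree only up to \<kappa> (\<open>Id x y\<close> -
  \<open>Id y x\<close>), and \<open>Id\<close> vanishes because the \<open>D2\<close> parts lie in
  one quaternionic line.\<close>

lemma curv_half_formula:
  assumes a: "a > 0" "\<kappa> = (1 - a) / a" and q: "q \<in> sphere 0 1"
    and x: "horz q x" and y: "horz q y" and z: "horz q z" and w: "horz q w"
    and W: "\<And>u v t. W u v t = ga_lift a q v t *\<^sub>R u - ga_lift a q u t *\<^sub>R v"
    and I: "\<And>v. I v = mult_i v - 2 *\<^sub>R mult_i (D1_part q v)"
    and R: "\<And>v. R v = v - 2 *\<^sub>R D1_part q v"
  shows "(curv_half \<kappa> q x y z - curv_half \<kappa> q y x z) \<bullet> w =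
    (((a - 1) * (a + 2) / a\<^sup>2) *\<^sub>R W x y z
    + (1 / a) *\<^sub>R (W x y z + W (mult_i x) (mult_i y) z + (2 * ga_lift a q x (mult_i y)) *\<^sub>R mult_i z)
    + ((1 - a) / a\<^sup>2) *\<^sub>R (W x y z + W (I x) (I y) z + (2 * ga_lift a q x (I y)) *\<^sub>R I z)
    + ((1 - a) / a) *\<^sub>R (W x y (R z) + R (W x y z) - ((a + 2) / a) *\<^sub>R R (W x y (R z)))) \<bullet> w"
proof -
  have k: "a * (\<kappa> + 1) = 1"
    using a by (simp add: field_simps)
  have coeffs: "(a - 1) * (a + 2) / a\<^sup>2 = - \<kappa> * (3 + 2 * \<kappa>)" "1 / a = \<kappa> + 1" "(1 - a) / a\<^sup>2 = \<kappa> * (\<kappa> + 1)"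
    "(1 - a) / a = \<kappa>" "(a + 2) / a = 3 + 2 * \<kappa>"
    unfolding a(2) using a(1) by (simp_all add: field_simps power2_eq_square)
  have ga_lift: "ga_lift a q u v = a * ((u \<bullet> v) + \<kappa> * ((u \<bullet> mult_j q) * (v \<bullet> mult_j q) + (u \<bullet> mult_k q) * (v \<bullet> mult_k q)))"
    for u v
    by (simp add: ga_lift_def sphere_inner[OF q]) (use k in algebra)
  note basic = horz_simps[OF x] horz_simps[OF y] horz_simps[OF z] horz_simps[OF w] sphere_inner[OF q]
  have sw: "y \<bullet> mult_i x = - (x \<bullet> mult_i y)" "y \<bullet> mult_j x = - (x \<bullet> mult_j y)" "y \<bullet> mult_k x = - (x \<bullet> mult_k y)"
    "z \<bullet> mult_i x = - (x \<bullet> mult_i z)" "z \<bullet> mult_j x = - (x \<bullet> mult_j z)" "z \<bullet> mult_k x = - (x \<bullet> mult_k z)"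
    "z \<bullet> mult_i y = - (y \<bullet> mult_i z)" "z \<bullet> mult_j y = - (y \<bullet> mult_j z)" "z \<bullet> mult_k y = - (y \<bullet> mult_k z)"
    "q \<bullet> mult_j x = - (x \<bullet> mult_j q)" "q \<bullet> mult_k x = - (x \<bullet> mult_k q)"
    "q \<bullet> mult_j y = - (y \<bullet> mult_j q)" "q \<bullet> mult_k y = - (y \<bullet> mult_k q)"
    "q \<bullet> mult_j z = - (z \<bullet> mult_j q)" "q \<bullet> mult_k z = - (z \<bullet> mult_k q)"
    "q \<bullet> mult_j w = - (w \<bullet> mult_j q)" "q \<bullet> mult_k w = - (w \<bullet> mult_k q)"
    "y \<bullet> x = x \<bullet> y" "z \<bullet> x = x \<bullet> z" "z \<bullet> y = y \<bullet> z"
    using inner_mult_ijk_commute inner_commute by blast+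
  define d where "d u = u - D1_part q u" for u
  have orth: "quat_orth q (d u)" if "horz q u" for u
    using that by (simp add: d_def D1_part_def quat_orth_def inner_simps quaternion_simps horz_simps sphere_inner[OF q])
  \<comment> \<open>Left minus right side of the polarised identity for the components orthogonal to
    jq and kq.\<close>
  define Id where "Id u v = (d u \<bullet> mult_i (d v)) * (d z \<bullet> mult_i (d w)) + (d u \<bullet> mult_j (d v)) * (d z \<bullet> mult_j (d w)) +
    (d u \<bullet> mult_k (d v)) * (d z \<bullet> mult_k (d w)) + (d u \<bullet> mult_i (d z)) * (d v \<bullet> mult_i (d w)) +
    (d u \<bullet> mult_j (d z)) * (d v \<bullet> mult_j (d w)) + (d u \<bullet> mult_k (d z)) * (d v \<bullet> mult_k (d w)) -
    ((d u \<bullet> d z) * (d v \<bullet> d w) + (d u \<bullet> d v) * (d z \<bullet> d w) - 2 * (d u \<bullet> d w) * (d v \<bullet> d z))" for u v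
  have Id: "Id u v = 0" if "horz q v" for u v
    unfolding Id_def using quaternionic_line_polarized[OF sphere_nonzero[OF q] orth[OF that] orth[OF z] orth[OF w]] by simp
  have "(curv_half \<kappa> q x y z - curv_half \<kappa> q y x z) \<bullet> w =
    (((a - 1) * (a + 2) / a\<^sup>2) *\<^sub>R W x y z
    + (1 / a) *\<^sub>R (W x y z + W (mult_i x) (mult_i y) z + (2 * ga_lift a q x (mult_i y)) *\<^sub>R mult_i z)
    + ((1 - a) / a\<^sup>2) *\<^sub>R (W x y z + W (I x) (I y) z + (2 * ga_lift a q x (I y)) *\<^sub>R I z)
    + ((1 - a) / a) *\<^sub>R (W x y (R z) + R (W x y z) - ((a + 2) / a) *\<^sub>R R (W x y (R z)))) \<bullet> w +
    \<kappa> * Id x y - \<kappa> * Id y x"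
    unfolding coeffs W I R ga_lift Id_def d_def D1_part_def curv_half_def difference_tensor_def inner_simps
    by (simp add: inner_simps quaternion_simps basic sw) (use k in algebra)
  then show ?thesis
    using Id[OF x, of y] Id[OF y, of x] by simp
qed

theorem theorem4p1:
  fixes a :: real and X Y Z :: vfield and p :: cp3
  assumes "a > 0"
    and "X \<in> vector_fields" and "Y \<in> vector_fields" and "Z \<in> vector_fields"
  shows "riemann (ga a) X Y Z p =
      ((a - 1) * (a + 2) / a\<^sup>2) *\<^sub>R wedge a p (X p) (Y p) (Z p)
    + (1 / a) *\<^sub>R (wedge a p (X p) (Y p) (Z p)
        + wedge a p (J1 p (X p)) (J1 p (Y p)) (Z p)
        + (2 * ga a p (X p) (J1 p (Y p))) *\<^sub>R J1 p (Z p))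
    + ((1 - a) / a\<^sup>2) *\<^sub>R (wedge a p (X p) (Y p) (Z p)
        + wedge a p (J p (X p)) (J p (Y p)) (Z p)
        + (2 * ga a p (X p) (J p (Y p))) *\<^sub>R J p (Z p))
    + ((1 - a) / a) *\<^sub>R (wedge a p (X p) (Y p) (P p (Z p))
        + P p (wedge a p (X p) (Y p) (Z p))
        - ((a + 2) / a) *\<^sub>R P p (wedge a p (X p) (Y p) (P p (Z p))))"
proof -
  obtain q where q: "q \<in> sphere 0 1" "q \<noteq> 0" "proj q = p"
    using proj_surj by metis
  define x y z where xyz: "x = lift X q" "y = lift Y q" "z = lift Z q"
  have h: "horz q x" "horz q y" "horz q z"
    using lift_tangent(1) assms q(2) by (auto simp: xyz)
  have p: "X p = dproj q x" "Y p = dproj q y" "Z p = dproj q z"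
    using lift_tangent(2) assms q by (auto simp: xyz)
  define W where "W u v t = ga_lift a q v t *\<^sub>R u - ga_lift a q u t *\<^sub>R v" for u v t
  define I where "I v = mult_i v - 2 *\<^sub>R mult_i (D1_part q v)" for v
  define R where "R v = v - 2 *\<^sub>R D1_part q v" for v
  \<comment> \<open>The formulas for the tensors hold on horizontal vectors, so each nested argument
    has to be known horizontal before \<open>dproj\<close> can be moved outwards.\<close>
  have hor: "horz q (I v)" "horz q (R v)" "horz q (mult_i v)" if "horz q v" for v
    using that by (auto simp: I_def R_def intro!: horz_diff horz_scaleR horz_mult_i horz_D1_part)
  have horW: "horz q (W u v t)" if "horz q u" "horz q v" for u v t
    using that by (auto simp: W_def intro!: horz_diff horz_scaleR)
  have J: "J1 p (dproj q v) = dproj q (mult_i v)" "J p (dproj q v) = dproj q (I v)"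
    "P p (dproj q v) = dproj q (R v)" if "horz q v" for v
    using that q J1_dproj[OF q(1)] J_dproj[OF q(1)] P_dproj[OF q(1)] by (simp_all add: I_def R_def)
  have g: "ga a p (dproj q u) (dproj q v) = ga_lift a q u v" if "horz q u" "horz q v" for u v
    using that q ga_dproj[OF q(2)] by simp
  have wedge: "wedge a p (dproj q u) (dproj q v) (dproj q t) = dproj q (W u v t)"
    if "horz q u" "horz q v" "horz q t" for u v t
    using that q wedge_dproj[OF q(2)] by (simp add: W_def)
  define V where "V = ((a - 1) * (a + 2) / a\<^sup>2) *\<^sub>R W x y z
    + (1 / a) *\<^sub>R (W x y z + W (mult_i x) (mult_i y) z + (2 * ga_lift a q x (mult_i y)) *\<^sub>R mult_i z)
    + ((1 - a) / a\<^sup>2) *\<^sub>R (W x y z + W (I x) (I y) z + (2 * ga_lift a q x (I y)) *\<^sub>R I z)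
    + ((1 - a) / a) *\<^sub>R (W x y (R z) + R (W x y z) - ((a + 2) / a) *\<^sub>R R (W x y (R z)))"
  have "riemann (ga a) X Y Z p = dproj q (curv_half ((1 - a) / a) q x y z - curv_half ((1 - a) / a) q y x z)"
    using riemann_lift[OF assms q(1) refl] q(3) by (simp add: xyz)
  also have "\<dots> = dproj q V"
    unfolding V_def
    by (rule dproj_eqI_horz[OF q(2)]) (rule curv_half_formula[OF assms(1) refl q(1) h _ W_def I_def R_def])
  also have "\<dots> = ((a - 1) * (a + 2) / a\<^sup>2) *\<^sub>R wedge a p (X p) (Y p) (Z p)
    + (1 / a) *\<^sub>R (wedge a p (X p) (Y p) (Z p)
        + wedge a p (J1 p (X p)) (J1 p (Y p)) (Z p)
        + (2 * ga a p (X p) (J1 p (Y p))) *\<^sub>R J1 p (Z p))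
    + ((1 - a) / a\<^sup>2) *\<^sub>R (wedge a p (X p) (Y p) (Z p)
        + wedge a p (J p (X p)) (J p (Y p)) (Z p)
        + (2 * ga a p (X p) (J p (Y p))) *\<^sub>R J p (Z p))
    + ((1 - a) / a) *\<^sub>R (wedge a p (X p) (Y p) (P p (Z p))
        + P p (wedge a p (X p) (Y p) (Z p))
        - ((a + 2) / a) *\<^sub>R P p (wedge a p (X p) (Y p) (P p (Z p))))"
    unfolding V_def linear_add[OF linear_dproj[OF q(2)]] linear_diff[OF linear_dproj[OF q(2)]]
      linear_cmul[OF linear_dproj[OF q(2)]]
    by (simp only: p J g wedge hor horW h)
  finally show ?thesis .
qed

end
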